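(* Suppose $U$ satisfies Assumption (U) and $G$ satisfies Assumption (G1) (see context). 1. (Multi-particle.) Let $N\ge2$. For $(\mathbf{q}_0,\mathbf{p}_0)\in\mathbf{X}$ let $(\mathbf{q}^\varepsilon(t),\mathbf{p}^\varepsilon(t))$ solve the relativistic system and $(\mathbf{q}(t),\mathbf{p}(t))$ solve the Langevin system (see context), both started at $(\mathbf{q}_0,\mathbf{p}_0)$ and driven by the same Brownian motions. Then for all $T>0$ and $\xi>0$, $$\mathbb{P}\Big(\sup_{t\in[0,T]}\big[|\mathbf{q}^\varepsilon(t)-\mathbf{q}(t)|+|\mathbf{p}^\varepsilon(t)-\mathbf{p}(t)|\big]>\xi\Big)\to0\quad\text{as }\varepsilon\to0.$$ 2. (Single-particle.) Let $N=1$. For $(q_0,p_0)\in(\mathbb{R}^d\setminus\{0\})\times\mathbb{R}^d$ let $(q^\varepsilon,p^\varepsilon)$ and $(q,p)$ solve the single-particle relativistic and Langevin systems (see context) with initial condition $(q_0,p_0)$ and the same Brownian motion. Then for all $T>0$ and $n\ge1$, $$\mathbb{E}\sup_{t\in[0,T]}\big[|q^\varepsilon(t)-q(t)|^n+|p^\varepsilon(t)-p(t)|^n\big]\to0\quad\text{as }\varepsilon\to0.$$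
   Context: Assumption (U): $U\in C^\infty(\mathbb{R}^d;[1,\infty))$ and there are constants $a_1>0$, $\lambda\ge 1$, $a_2,a_3>0$ such that for all $q$: $\frac{1}{a_1}|q|^{\lambda+1}-a_1\le |U(q)|\le a_1(1+|q|^{\lambda+1})$, $|\nabla U(q)|\le a_1(1+|q|^\lambda)$, $\langle\nabla U(q),q\rangle\ge a_2|q|^{\lambda+1}-a_3$. Assumption (G1): $G\in C^\infty(\mathbb{R}^d\setminus\{0\};\mathbb{R})$, $G(q)\to\infty$ as $|q|\to0$, $G$ even, $\nabla G$ odd; there is $\beta_1\ge1$ with $|G(q)|\le a_1(1+|q|+|q|^{-\beta_1})$, $|\nabla G(q)|\le a_1(1+|q|^{-\beta_1})$; and constants $\beta_2\in[0,\beta_1)$, $a_4>0$, $a_5\in\mathbb{R}$, $a_6>0$ with $\big|\nabla G(q)+a_4\frac{q}{|q|^{\beta_1+1}}+a_5\frac{q}{|q|^{\beta_2+1}}\big|\le a_6$ for $q\ne0$. For $N\ge2$: $\mathcal{D}=\{\mathbf{q}\in(\mathbb{R}^d)^N:q_i\ne q_j\ (i\ne j)\}$, $\mathbf{X}=\mathcal{D}\times(\mathbb{R}^d)^N$; $W_1,\dots,W_N$ i.i.d. standard $d$-dimensional Brownian motions. Relativistic system ($\varepsilon\in(0,1)$): $dq_i=\frac{p_i}{\sqrt{1+\varepsilon|p_i|^2}}dt$, $dp_i=-\frac{p_i}{\sqrt{1+\varepsilon|p_i|^2}}dt-\nabla U(q_i)dt-\sum_{j\ne i}\nabla G(q_i-q_j)dt+\sqrt2\,dW_i$.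 Langevin system: $dq_i=p_i\,dt$, $dp_i=-p_i\,dt-\nabla U(q_i)dt-\sum_{j\ne i}\nabla G(q_i-q_j)dt+\sqrt2\,dW_i$. For $N=1$: relativistic system $dq=\frac{p}{\sqrt{1+\varepsilon|p|^2}}dt$, $dp=-\frac{p}{\sqrt{1+\varepsilon|p|^2}}dt-\nabla U(q)dt-\nabla G(q)dt+\sqrt2\,dW$; Langevin system $dq=p\,dt$, $dp=-p\,dt-\nabla U(q)dt-\nabla G(q)dt+\sqrt2\,dW$. *)

theory Defs
  imports "HOL-Analysis.Analysis" "HOL-Probability.Probability"
begin

fun iter_dd :: "('a::real_normed_vector \<Rightarrow> real) \<Rightarrow> 'a list \<Rightarrow> 'a \<Rightarrow> real" where
  "iter_dd f [] = f"
| "iter_dd f (v # vs) = (\<lambda>x. frechet_derivative (iter_dd f vs) (at x) v)"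

definition smooth_on :: "'a::real_normed_vector set \<Rightarrow> ('a \<Rightarrow> real) \<Rightarrow> bool" where
  "smooth_on S f \<longleftrightarrow> (\<forall>vs. \<forall>x\<in>S. iter_dd f vs differentiable (at x))"

definition gauss_density :: "real \<Rightarrow> 'b::euclidean_space \<Rightarrow> real" where
  "gauss_density s x = (2 * pi * s) powr (- real DIM('b) / 2) * exp (- (norm x)\<^sup>2 / (2 * s))"

definition std_BM :: "'a measure \<Rightarrow> (real \<Rightarrow> 'a \<Rightarrow> 'b::euclidean_space) \<Rightarrow> bool" where
  "std_BM M W \<longleftrightarrow> prob_space M
    \<and> (\<forall>t. W t \<in> borel_measurable M)
    \<and> (\<forall>\<omega>\<in>space M. W 0 \<omega> = 0 \<and> continuous_on {0..} (\<lambda>t. W t \<omega>))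
    \<and> (\<forall>s t. 0 \<le> s \<and> s < t \<longrightarrow>
          distributed M lborel (\<lambda>\<omega>. W t \<omega> - W s \<omega>) (\<lambda>x. ennreal (gauss_density (t - s) x)))
    \<and> (\<forall>n (\<tau>::nat \<Rightarrow> real). 0 \<le> \<tau> 0 \<and> (\<forall>i<n. \<tau> i \<le> \<tau> (Suc i)) \<longrightarrow>
          prob_space.indep_vars M (\<lambda>_. borel) (\<lambda>i \<omega>. W (\<tau> (Suc i)) \<omega> - W (\<tau> i) \<omega>) {..<n})"

definition iid_BMs :: "'a measure \<Rightarrow> (real \<Rightarrow> 'a \<Rightarrow> real^'d^'n) \<Rightarrow> bool" where
  "iid_BMs M W \<longleftrightarrow> (\<forall>i. std_BM M (\<lambda>t \<omega>. W t \<omega> $ i))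
    \<and> prob_space.indep_vars M (\<lambda>_. Pi\<^sub>M UNIV (\<lambda>_. (borel :: (real^'d) measure)))
         (\<lambda>i \<omega>. (\<lambda>t. W t \<omega> $ i)) UNIV"

definition rel_vel :: "real \<Rightarrow> real^'d \<Rightarrow> real^'d" where
  "rel_vel \<epsilon> p = (1 / sqrt (1 + \<epsilon> * (norm p)\<^sup>2)) *\<^sub>R p"

definition rel_vel_multi :: "real \<Rightarrow> real^'d^'n \<Rightarrow> real^'d^'n" where
  "rel_vel_multi \<epsilon> P = (\<chi> i. rel_vel \<epsilon> (P $ i))"

definition force_multi :: "(real^'d \<Rightarrow> real^'d) \<Rightarrow> (real^'d \<Rightarrow> real^'d) \<Rightarrow> real^'d^'n \<Rightarrow> real^'d^'n" where
  "force_multi gU gG Q = (\<chi> i. gU (Q $ i) + (\<Sum>j\<in>UNIV - {i}. gG (Q $ i - Q $ j)))"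

definition coll_free :: "(real^'d^'n) set" where
  "coll_free = {Q. \<forall>i j. i \<noteq> j \<longrightarrow> Q $ i \<noteq> Q $ j}"

text \<open>(q,p) is a (pathwise, integral-form) solution on [0,\<infinity>) of
   dq = vel(p) dt,  dp = -vel(p) dt - F(q) dt + sqrt 2 dW,  q(0)=q0, p(0)=p0,
  staying in the domain S for all times; the processes are random variables at each
  time and have continuous paths.\<close>
definition solves :: "'a measure \<Rightarrow> ('v::euclidean_space \<Rightarrow> 'v) \<Rightarrow> ('v \<Rightarrow> 'v) \<Rightarrow> 'v set
    \<Rightarrow> (real \<Rightarrow> 'a \<Rightarrow> 'v) \<Rightarrow> 'v \<Rightarrow> 'v \<Rightarrow> (real \<Rightarrow> 'a \<Rightarrow> 'v) \<Rightarrow> (real \<Rightarrow> 'a \<Rightarrow> 'v) \<Rightarrow> bool" where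
  "solves M vel F S W q0 p0 q p \<longleftrightarrow>
     (\<forall>t. q t \<in> borel_measurable M \<and> p t \<in> borel_measurable M)
   \<and> (\<forall>\<omega>\<in>space M. continuous_on {0..} (\<lambda>t. q t \<omega>) \<and> continuous_on {0..} (\<lambda>t. p t \<omega>))
   \<and> (AE \<omega> in M. \<forall>t\<ge>0. q t \<omega> \<in> S
        \<and> q t \<omega> = q0 + integral {0..t} (\<lambda>s. vel (p s \<omega>))
        \<and> p t \<omega> = p0 + integral {0..t} (\<lambda>s. - vel (p s \<omega>) - F (q s \<omega>)) + sqrt 2 *\<^sub>R W t \<omega>)"

end

theory Submission
  imports Defs
begin

text \<open>
  The noise is additive, so everything is pathwise. On [0,T] the limiting path has compact image in
  the open set where the force is locally Lipschitz, and the relativistic velocity is nonexpansive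
  and differs from p by at most \<open>\<epsilon>|p|\<^sup>3\<close>; Gronwall's inequality up to the exit from a tube around
  the limiting path gives uniform convergence for almost every noise path. This already implies
  convergence in probability.

  For convergence of moments one needs an \<open>\<epsilon>\<close>-independent integrable bound on the paths. Replace
  \<open>\<surd>2 W\<close> by its moving average over a window \<open>\<delta>\<close> so short that the error h is uniformly small, and
  put \<open>y = p - h\<close>. The energy \<open>E = K(y) + U(q) + G(q)\<close> then grows at most at rate \<open>|h| |\<nabla>G(q)|\<close> plus
  harmless terms, and the singular term is compensated by the radial momentum \<open>Z = \<langle>y, q/|q|\<rangle>\<close>,
  whose derivative is at least a multiple of \<open>|q|\<^bsup>-\<beta>1\<^esup>\<close> because G is repulsive. So
  \<open>E - \<kappa> Z\<close> has a bounded derivative, and the paths are bounded by a multiple of \<open>1 + \<delta>\<^bsup>-2\<^esup>\<close>.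
  Kolmogorov's chaining argument shows that \<open>1/\<delta>\<close> has moments of all orders, so dominated
  convergence applies.
\<close>

section \<open>Locally Lipschitz forces\<close>

text \<open>The obstacle in the moment bound is that, uniformly in \<epsilon>, the kinetic energy
  controls the momentum only linearly, \<open>norm y \<le> K y + 2\<close>. The radial momentum
  \<open>Z\<close> is then as large as the energy itself, so it may be subtracted only with a small
  weight \<kappa>. This weight must cancel a loss proportional to the bound \<eta> on
  \<open>h\<close>, hence \<kappa> is a fixed multiple of \<eta>. So \<eta> has to lie below a
  threshold given by T and the constants of the potentials, and subtracting the whole noise from p
  would not do. Such a small \<open>h\<close> is bought by a window \<delta> that depends on the
  noise path, at the price of an extra drift of size \<eta>/\<delta>; this is how moments of
  1/\<delta> enter. The window depends on neither \<epsilon> nor the velocity law, so one dominating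
  function serves the limit and all its approximations.\<close>

definition loc_lip :: "'a::metric_space set \<Rightarrow> ('a \<Rightarrow> 'b::metric_space) \<Rightarrow> bool" where
  "loc_lip S F \<longleftrightarrow> (\<forall>x\<in>S. \<exists>r>0. \<exists>L. L-lipschitz_on (cball x r \<inter> S) F)"

lemma loc_lip_add:
  fixes F G :: "'a::metric_space \<Rightarrow> 'b::real_normed_vector"
  assumes "loc_lip S F" "loc_lip S G"
  shows "loc_lip S (\<lambda>x. F x + G x)"
  unfolding loc_lip_def
proof
  fix x assume "x \<in> S"
  then obtain r L r' L' where *: "r > 0" "L-lipschitz_on (cball x r \<inter> S) F"
    "r' > 0" "L'-lipschitz_on (cball x r' \<inter> S) G"
    using assms unfolding loc_lip_def by meson
  have "(L + L')-lipschitz_on (cball x (min r r') \<inter> S) (\<lambda>x. F x + G x)"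
    by (intro lipschitz_on_add lipschitz_on_subset[OF *(2)] lipschitz_on_subset[OF *(4)]) auto
  then show "\<exists>r>0. \<exists>L. L-lipschitz_on (cball x r \<inter> S) (\<lambda>x. F x + G x)"
    using * by (intro exI[of _ "min r r'"]) auto
qed

lemma loc_lip_const: "loc_lip S (\<lambda>_. c)"
  unfolding loc_lip_def by (auto intro!: exI[of _ "1::real"] simp: lipschitz_on_def)

lemma loc_lip_sum:
  fixes F :: "'i \<Rightarrow> 'a::metric_space \<Rightarrow> 'b::real_normed_vector"
  assumes "\<And>i. i \<in> I \<Longrightarrow> loc_lip S (F i)"
  shows "loc_lip S (\<lambda>x. \<Sum>i\<in>I. F i x)"
  using assms by (induction I rule: infinite_finite_induct) (auto intro: loc_lip_const loc_lip_add)

lemma loc_lip_comp_linear: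
  assumes F: "loc_lip S F" and g: "bounded_linear g" and gS: "g ` R \<subseteq> S"
  shows "loc_lip R (\<lambda>x. F (g x))"
  unfolding loc_lip_def
proof
  fix x assume x: "x \<in> R"
  then obtain r L where r: "r > 0" and L: "L-lipschitz_on (cball (g x) r \<inter> S) F"
    using F gS unfolding loc_lip_def by blast
  obtain K where K: "K > 0" "\<And>v. norm (g v) \<le> norm v * K"
    using bounded_linear.pos_bounded[OF g] by blast
  have gd: "dist (g u) (g v) \<le> K * dist u v" for u v
    using K(2)[of "u - v"] by (simp add: dist_norm linear_diff[OF bounded_linear.linear[OF g]] mult.commute)
  have "K-lipschitz_on (cball x (r / K) \<inter> R) g"
    using gd K by (auto intro!: lipschitz_onI)
  moreover have "g ` (cball x (r / K) \<inter> R) \<subseteq> cball (g x) r \<inter> S"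
  proof safe
    fix z assume "z \<in> cball x (r/K)" "z \<in> R"
    then show "g z \<in> cball (g x) r" "g z \<in> S"
      using gd[of x z] K gS by (auto simp: field_simps intro: order_trans)
  qed
  ultimately have "(L * K)-lipschitz_on (cball x (r / K) \<inter> R) (\<lambda>x. F (g x))"
    using lipschitz_on_compose2 lipschitz_on_subset[OF L] by blast
  then show "\<exists>r>0. \<exists>L. L-lipschitz_on (cball x r \<inter> R) (\<lambda>x. F (g x))"
    using r K by (intro exI[of _ "r / K"]) auto
qed

lemma loc_lip_linear_comp:
  assumes F: "loc_lip S F" and g: "bounded_linear g"
  shows "loc_lip S (\<lambda>x. g (F x))"
  unfolding loc_lip_def
proof
  fix x assume x: "x \<in> S"
  then obtain r L where r: "r > 0" and L: "L-lipschitz_on (cball x r \<inter> S) F"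
    using F unfolding loc_lip_def by blast
  obtain K where K: "K > 0" "\<And>v. norm (g v) \<le> norm v * K"
    using bounded_linear.pos_bounded[OF g] by blast
  have "dist (g u) (g v) \<le> K * dist u v" for u v
    using K(2)[of "u - v"] by (simp add: dist_norm linear_diff[OF bounded_linear.linear[OF g]] mult.commute)
  then have "K-lipschitz_on (F ` (cball x r \<inter> S)) g"
    using K by (auto intro!: lipschitz_onI)
  from lipschitz_on_compose2[OF L this] r
  show "\<exists>r>0. \<exists>L. L-lipschitz_on (cball x r \<inter> S) (\<lambda>x. g (F x))"
    by blast
qed

lemma loc_lip_euclidean:
  fixes F :: "'a::metric_space \<Rightarrow> 'b::euclidean_space"
  assumes "\<And>b. b \<in> Basis \<Longrightarrow> loc_lip S (\<lambda>x. F x \<bullet> b)"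
  shows "loc_lip S F"
proof -
  have "loc_lip S (\<lambda>x. \<Sum>b\<in>Basis. (F x \<bullet> b) *\<^sub>R b)"
    by (intro loc_lip_sum loc_lip_linear_comp[OF assms]) (auto intro: bounded_linear_scaleR_left)
  then show ?thesis by (simp add: euclidean_representation)
qed

lemma loc_lip_vec:
  fixes F :: "'a::metric_space \<Rightarrow> ('b::euclidean_space)^'n"
  assumes "\<And>i. loc_lip S (\<lambda>x. F x $ i)"
  shows "loc_lip S F"
proof (rule loc_lip_euclidean)
  fix b :: "'b^'n" assume "b \<in> Basis"
  then obtain i u where b: "b = axis i u" by (auto simp: Basis_vec_def)
  show "loc_lip S (\<lambda>x. F x \<bullet> b)"
    unfolding b inner_axis by (rule loc_lip_linear_comp[OF assms bounded_linear_inner_left])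
qed

lemma loc_lip_continuous_on: "loc_lip S F \<Longrightarrow> open S \<Longrightarrow> continuous_on S F"
  unfolding continuous_on_eq_continuous_at
proof
  fix x assume F: "loc_lip S F" and S: "open S" and x: "x \<in> S"
  then obtain r L where r: "r > 0" and L: "L-lipschitz_on (cball x r \<inter> S) F"
    unfolding loc_lip_def by blast
  have "continuous_on (ball x r \<inter> S) F"
    by (rule continuous_on_subset[OF lipschitz_on_continuous_on[OF L]]) auto
  then show "isCont F x"
    using x r S by (simp add: continuous_on_eq_continuous_at open_Int)
qed

text \<open>Compactness alone suffices, without convexity of \<open>X\<close>: this is the known
  statement for time-dependent fields \<open>local_lipschitz\<close>, applied with the one-point
  time set {0}.\<close>

lemma loc_lip_compact:
  assumes F: "loc_lip S F" and X: "compact X" "X \<subseteq> S"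
  obtains L where "L-lipschitz_on X F"
proof -
  have "local_lipschitz {0::real} S (\<lambda>_. F)"
    unfolding local_lipschitz_def
  proof safe
    fix x assume "x \<in> S"
    then obtain r L where r: "r > 0" and L: "L-lipschitz_on (cball x r \<inter> S) F"
      using F unfolding loc_lip_def by blast
    then show "\<exists>u>0. \<exists>L. \<forall>t\<in>cball (0::real) u \<inter> {0}. L-lipschitz_on (cball x u \<inter> S) F"
      by (intro exI[of _ r]) auto
  qed
  then have "local_lipschitz {0::real} X (\<lambda>_. F)"
    by (rule local_lipschitz_subset) (use X in auto)
  from local_lipschitz_compact_implies_lipschitz[OF this X(1), of thesis] that
  show thesis by auto
qed

section \<open>Gradients of smooth potentials\<close>

lemma iter_dd_1:
  assumes "GDERIV f x :> g"
  shows "iter_dd f [v] x = g \<bullet> v"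
  using frechet_derivative_at[OF assms[unfolded gderiv_def], symmetric] by (simp add: inner_commute)

lemma iter_dd_has_derivative:
  assumes "iter_dd f vs differentiable (at x)"
  shows "(iter_dd f vs has_derivative (\<lambda>w. iter_dd f (w # vs) x)) (at x)"
  using assms by (simp add: frechet_derivative_works)

text \<open>Each component of the gradient is a first directional derivative of f, and its own
  derivative is continuous by smoothness. On a closed ball the second derivatives are bounded
  separately for each direction \<open>w\<close>; linearity in \<open>w\<close> and the finite basis
  turn this into an operator norm bound, and the ball is convex, so the mean value inequality
  applies.\<close>

lemma smooth_on_loc_lip_grad:
  fixes f :: "'a::euclidean_space \<Rightarrow> real"
  assumes sm: "smooth_on S f" and S: "open S" and g: "\<And>x. x \<in> S \<Longrightarrow> GDERIV f x :> g x"
  shows "loc_lip S g"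
proof (rule loc_lip_euclidean)
  fix b :: 'a assume b: "b \<in> Basis"
  show "loc_lip S (\<lambda>x. g x \<bullet> b)" unfolding loc_lip_def
  proof
    fix x assume x: "x \<in> S"
    obtain r where r: "r > 0" "cball x r \<subseteq> S" using S x open_contains_cball by blast
    have d: "(iter_dd f [b] has_derivative (\<lambda>w. iter_dd f [w, b] z)) (at z)" if "z \<in> S" for z
      using sm that unfolding smooth_on_def by (blast intro: iter_dd_has_derivative)
    have "\<exists>B. \<forall>z\<in>cball x r. norm (iter_dd f [w, b] z) \<le> B" for w
    proof -
      have "continuous_on (cball x r) (iter_dd f [w, b])"
        using sm r unfolding smooth_on_def
        by (intro continuous_at_imp_continuous_on) (blast intro: differentiable_imp_continuous_within)
      from compact_continuous_image[OF this compact_cball] show ?thesis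
        by (force simp: bounded_iff dest!: compact_imp_bounded)
    qed
    then obtain B where B: "\<And>w z. z \<in> cball x r \<Longrightarrow> norm (iter_dd f [w, b] z) \<le> B w" by metis
    have B0: "B w \<ge> 0" for w using B[of x w] r norm_ge_zero order_trans by force
    have "(\<Sum>w\<in>Basis. B w)-lipschitz_on (cball x r) (iter_dd f [b])"
    proof (rule bounded_derivative_imp_lipschitz)
      show "(iter_dd f [b] has_derivative (\<lambda>w. iter_dd f [w, b] z)) (at z within cball x r)"
        if "z \<in> cball x r" for z using d[of z] that r by (blast intro: has_derivative_at_withinI)
      show "onorm (\<lambda>w. iter_dd f [w, b] z) \<le> (\<Sum>w\<in>Basis. B w)" if z: "z \<in> cball x r" for z
      proof (rule onorm_le)
        fix h
        have lin: "linear (\<lambda>w. iter_dd f [w, b] z)"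
          using d[of z] z r has_derivative_linear by blast
        have "iter_dd f [h, b] z = (\<Sum>w\<in>Basis. (h \<bullet> w) *\<^sub>R iter_dd f [w, b] z)"
          using linear_sum[OF lin, of "\<lambda>w. (h \<bullet> w) *\<^sub>R w" Basis] linear_scale[OF lin]
          by (simp only: euclidean_representation)
        also have "norm \<dots> \<le> (\<Sum>w\<in>Basis. norm h * B w)"
          by (rule sum_norm_le) (use B[OF z] in
              \<open>auto simp: abs_mult intro!: mult_mono Basis_le_norm\<close>)
        finally show "norm (iter_dd f [h, b] z) \<le> (\<Sum>w\<in>Basis. B w) * norm h"
          by (simp add: sum_distrib_left mult.commute)
      qed
    qed (auto intro: sum_nonneg B0)
    moreover have "iter_dd f [b] z = g z \<bullet> b" if "z \<in> cball x r" for z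
      using that r g iter_dd_1 by blast
    ultimately have "(\<Sum>w\<in>Basis. B w)-lipschitz_on (cball x r \<inter> S) (\<lambda>x. g x \<bullet> b)"
      by (auto simp: lipschitz_on_def simp del: iter_dd.simps)
    then show "\<exists>r>0. \<exists>L. L-lipschitz_on (cball x r \<inter> S) (\<lambda>x. g x \<bullet> b)" using r by blast
  qed
qed

lemma open_coll_free: "open (coll_free :: (real^'d^'n) set)"
proof -
  have eq: "(coll_free :: (real^'d^'n) set) = (\<Inter>i. \<Inter>j\<in>-{i}. {Q. Q $ i \<noteq> Q $ j})"
    by (auto simp: coll_free_def)
  show ?thesis
    unfolding eq by (intro open_INT ballI open_Collect_neq continuous_intros) auto
qed

text \<open>Every pair force is \<open>gG\<close> composed with the linear map sending Q to
  \<open>Q $ i - Q $ j\<close>, which takes collision-free configurations into the complement of the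
  singularity.\<close>

lemma loc_lip_force_multi:
  assumes U: "loc_lip UNIV gU" and G: "loc_lip (- {0}) gG"
  shows "loc_lip (coll_free :: (real^'d^'n) set) (force_multi gU gG)"
proof (rule loc_lip_vec)
  fix i
  have "loc_lip coll_free (\<lambda>Q::real^'d^'n. gU (Q $ i))"
    by (rule loc_lip_comp_linear[OF U bounded_linear_vec_nth]) auto
  moreover have "loc_lip coll_free (\<lambda>Q::real^'d^'n. gG (Q $ i - Q $ j))" if "j \<in> UNIV - {i}" for j
    by (rule loc_lip_comp_linear[OF G])
       (use that in \<open>auto intro!: bounded_linear_sub bounded_linear_vec_nth simp: coll_free_def\<close>)
  ultimately show "loc_lip coll_free (\<lambda>x::real^'d^'n. force_multi gU gG x $ i)"
    unfolding force_multi_def vec_lambda_beta by (intro loc_lip_add loc_lip_sum)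
qed

section \<open>Velocities and kinetic energies\<close>

text \<open>The properties shared, uniformly in \<open>0 < \<epsilon> < 1\<close>, by the classical and the relativistic
  velocity v and kinetic energy K.\<close>
definition kinetic :: "('v::euclidean_space \<Rightarrow> 'v) \<Rightarrow> ('v \<Rightarrow> real) \<Rightarrow> bool" where
  "kinetic v K \<longleftrightarrow> (\<forall>y. GDERIV K y :> v y) \<and> (\<forall>x y. norm (v x - v y) \<le> norm (x - y))
     \<and> (\<forall>y. \<exists>c. 0 \<le> c \<and> c \<le> 1 \<and> v y = c *\<^sub>R y)
     \<and> (\<forall>y. 0 \<le> K y \<and> norm y \<le> K y + 2 \<and> (norm (v y))\<^sup>2 \<le> 2 * K y \<and> K y \<le> (norm y)\<^sup>2)"

lemma kinetic_id: "kinetic (\<lambda>y. y) (\<lambda>y. (norm y)\<^sup>2 / 2)"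
proof -
  have "GDERIV (\<lambda>y::'a::euclidean_space. (norm y)\<^sup>2 / 2) y :> y" for y
    unfolding gderiv_def power2_norm_eq_inner
    by (auto intro!: derivative_eq_intros simp: inner_commute)
  moreover have "norm y \<le> (norm y)\<^sup>2 / 2 + 2" for y :: "'a::euclidean_space"
    using sum_power2_ge_zero[of "norm y - 1" 0] by (simp add: power2_eq_square algebra_simps)
  ultimately show ?thesis unfolding kinetic_def by (auto intro: exI[of _ 1])
qed

text \<open>The relativistic speed as a function of the size of the momentum. For monotonicity,
  cross-multiply and square: the mixed terms cancel. For the slope, replacing the denominator at t
  by the larger one at s leaves s - t over a number at least 1.\<close>

lemma rel_factor_mono_lipschitz:
  fixes s t \<epsilon> :: real
  assumes "0 < \<epsilon>" "0 \<le> t" "t \<le> s"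
  shows "0 \<le> s / sqrt (1 + \<epsilon> * s\<^sup>2) - t / sqrt (1 + \<epsilon> * t\<^sup>2)"
    and "s / sqrt (1 + \<epsilon> * s\<^sup>2) - t / sqrt (1 + \<epsilon> * t\<^sup>2) \<le> s - t"
proof -
  have ge1: "1 \<le> sqrt (1 + \<epsilon> * s\<^sup>2)" "1 \<le> sqrt (1 + \<epsilon> * t\<^sup>2)" using assms by auto
  have st: "sqrt (1 + \<epsilon> * t\<^sup>2) \<le> sqrt (1 + \<epsilon> * s\<^sup>2)" using assms by (auto intro!: mult_left_mono power_mono)
  have "t * sqrt (1 + \<epsilon> * s\<^sup>2) \<le> s * sqrt (1 + \<epsilon> * t\<^sup>2)"
  proof (rule power2_le_imp_le)
    have p: "0 \<le> 1 + \<epsilon> * s\<^sup>2" "0 \<le> 1 + \<epsilon> * t\<^sup>2" using assms by (auto intro!: add_nonneg_nonneg)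
    have "t\<^sup>2 \<le> s\<^sup>2" using assms by (intro power_mono) auto
    then show "(t * sqrt (1 + \<epsilon> * s\<^sup>2))\<^sup>2 \<le> (s * sqrt (1 + \<epsilon> * t\<^sup>2))\<^sup>2"
      using p by (simp add: power_mult_distrib algebra_simps)
  qed (use assms in auto)
  then show "0 \<le> s / sqrt (1 + \<epsilon> * s\<^sup>2) - t / sqrt (1 + \<epsilon> * t\<^sup>2)"
    using ge1 by (simp add: field_simps)
  have "t / sqrt (1 + \<epsilon> * s\<^sup>2) \<le> t / sqrt (1 + \<epsilon> * t\<^sup>2)"
    using st ge1 assms by (intro divide_left_mono mult_pos_pos) (auto intro: less_le_trans[OF zero_less_one])
  then have "s / sqrt (1 + \<epsilon> * s\<^sup>2) - t / sqrt (1 + \<epsilon> * t\<^sup>2) \<le> (s - t) / sqrt (1 + \<epsilon> * s\<^sup>2)"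
    by (simp add: diff_divide_distrib)
  also have "\<dots> \<le> (s - t) / 1" using ge1 assms by (intro divide_left_mono) linarith+
  finally show "s / sqrt (1 + \<epsilon> * s\<^sup>2) - t / sqrt (1 + \<epsilon> * t\<^sup>2) \<le> s - t" by simp
qed

text \<open>The squared distance splits into a radial part, the squared difference of the lengths,
  and the nonnegative angular defect \<open>norm x * norm y - x \<bullet> y\<close> with weight
  \<open>2 / (A * B)\<close>. The radial part shrinks by the scalar estimate, and the weight is at
  most 2.\<close>

lemma rel_vel_nonexpansive:
  assumes e: "0 < \<epsilon>"
  shows "norm (rel_vel \<epsilon> x - rel_vel \<epsilon> y) \<le> norm (x - y)"
proof -
  define A B where "A = sqrt (1 + \<epsilon> * (norm x)\<^sup>2)" and "B = sqrt (1 + \<epsilon> * (norm y)\<^sup>2)"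
  have ge1: "1 \<le> A" "1 \<le> B" using e by (auto simp: A_def B_def)
  have "\<bar>norm x / A - norm y / B\<bar> \<le> \<bar>norm x - norm y\<bar>"
    using rel_factor_mono_lipschitz[OF e, of "norm y" "norm x"] rel_factor_mono_lipschitz[OF e, of "norm x" "norm y"]
    unfolding A_def B_def by (cases "norm x \<le> norm y") force+
  then have sc: "(norm x / A - norm y / B)\<^sup>2 \<le> (norm x - norm y)\<^sup>2"
    by (simp add: abs_le_square_iff)
  have k: "0 \<le> 1 - 1 / (A * B)" using mult_mono[OF ge1] ge1 by simp
  have expand: "(norm (a *\<^sub>R x - b *\<^sub>R y))\<^sup>2 = (a * norm x)\<^sup>2 + (b * norm y)\<^sup>2 - 2 * (a * b) * (x \<bullet> y)" for a b
    by (simp add: power2_norm_eq_inner inner_diff algebra_simps inner_commute power_mult_distrib)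
      (simp add: power2_eq_square)
  have "(norm (rel_vel \<epsilon> x - rel_vel \<epsilon> y))\<^sup>2 = (norm x / A)\<^sup>2 + (norm y / B)\<^sup>2 - 2 / (A * B) * (x \<bullet> y)"
    using expand[of "1 / A" "1 / B"] by (simp add: rel_vel_def A_def B_def)
  also have "\<dots> = (norm x / A - norm y / B)\<^sup>2 + 2 * (1 / (A * B)) * (norm x * norm y - x \<bullet> y)"
    by (simp add: power2_eq_square algebra_simps)
  also have "\<dots> \<le> (norm x - norm y)\<^sup>2 + 2 * 1 * (norm x * norm y - x \<bullet> y)"
    using sc k norm_cauchy_schwarz[of x y] by (intro add_mono mult_right_mono mult_left_mono) auto
  also have "\<dots> = (norm (x - y))\<^sup>2"
    using expand[of 1 1] by (simp add: power2_eq_square algebra_simps)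
  finally show ?thesis by (rule power2_le_imp_le) simp
qed

text \<open>The cubic growth is harmless, since the bound is applied only along the limiting path,
  which is bounded on [0,T].\<close>

lemma rel_vel_near_id:
  assumes e: "0 < \<epsilon>"
  shows "norm (rel_vel \<epsilon> x - x) \<le> \<epsilon> * norm x ^ 3"
proof -
  define A where "A = sqrt (1 + \<epsilon> * (norm x)\<^sup>2)"
  have ge1: "1 \<le> A" using e by (auto simp: A_def)
  have A2: "A\<^sup>2 = 1 + \<epsilon> * (norm x)\<^sup>2" using e by (simp add: A_def add_nonneg_nonneg)
  have "1 - 1 / A \<le> \<epsilon> * (norm x)\<^sup>2"
  proof -
    have "1 - 1 / A = (A - 1) / A" using ge1 by (simp add: field_simps)
    also have "\<dots> \<le> (A - 1) / 1" using ge1 by (intro divide_left_mono) auto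
    also have "\<dots> \<le> A\<^sup>2 - 1" using ge1 mult_right_mono[of 1 A A] by (simp add: power2_eq_square)
    finally show ?thesis using A2 by simp
  qed
  moreover have "rel_vel \<epsilon> x - x = - ((1 - 1 / A) *\<^sub>R x)"
    by (simp add: rel_vel_def A_def algebra_simps)
  then have "norm (rel_vel \<epsilon> x - x) = (1 - 1 / A) * norm x" using ge1 by simp
  ultimately have "norm (rel_vel \<epsilon> x - x) \<le> (\<epsilon> * (norm x)\<^sup>2) * norm x"
    by (simp add: mult_right_mono)
  then show ?thesis by (simp add: power3_eq_cube power2_eq_square mult_ac)
qed

lemma rel_vel_multi_nonexpansive:
  assumes "0 < \<epsilon>"
  shows "norm (rel_vel_multi \<epsilon> x - rel_vel_multi \<epsilon> y) \<le> norm (x - y)"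
  unfolding norm_vec_def[of "rel_vel_multi \<epsilon> x - rel_vel_multi \<epsilon> y"] norm_vec_def[of "x - y"]
  by (rule L2_set_mono) (simp_all add: rel_vel_multi_def rel_vel_nonexpansive assms)

lemma rel_vel_multi_near_id:
  fixes x :: "real^'d^'n"
  assumes "0 < \<epsilon>"
  shows "norm (rel_vel_multi \<epsilon> x - x) \<le> real CARD('n) * \<epsilon> * norm x ^ 3"
proof -
  have "norm (rel_vel_multi \<epsilon> x - x) \<le> (\<Sum>i\<in>UNIV. norm ((rel_vel_multi \<epsilon> x - x) $ i))"
    unfolding norm_vec_def[of "rel_vel_multi \<epsilon> x - x"] by (rule L2_set_le_sum) simp
  also have "\<dots> \<le> (\<Sum>i\<in>(UNIV::'n set). \<epsilon> * norm x ^ 3)"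
  proof (rule sum_mono)
    fix i
    have "norm ((rel_vel_multi \<epsilon> x - x) $ i) \<le> \<epsilon> * norm (x $ i) ^ 3"
      using rel_vel_near_id[OF assms] by (simp add: rel_vel_multi_def)
    also have "\<dots> \<le> \<epsilon> * norm x ^ 3"
      using assms by (intro mult_left_mono power_mono Finite_Cartesian_Product.norm_nth_le) auto
    finally show "norm ((rel_vel_multi \<epsilon> x - x) $ i) \<le> \<epsilon> * norm x ^ 3" .
  qed
  finally show ?thesis by simp
qed

lemma kinetic_rel_vel:
  assumes e: "0 < \<epsilon>" "\<epsilon> < 1"
  shows "kinetic (rel_vel \<epsilon>) (\<lambda>y::real^'d. (sqrt (1 + \<epsilon> * (norm y)\<^sup>2) - 1) / \<epsilon>)"
  unfolding kinetic_def
proof (intro conjI allI)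
  fix x y :: "real^'d"
  define A where "A = sqrt (1 + \<epsilon> * (norm y)\<^sup>2)"
  have ge1: "1 \<le> A" using e by (auto simp: A_def)
  have pos: "0 < 1 + \<epsilon> * (y \<bullet> y)" using e by (intro add_pos_nonneg) auto
  have "A\<^sup>2 = 1 + \<epsilon> * (norm y)\<^sup>2" using e by (simp add: A_def add_nonneg_nonneg)
  \<comment> \<open>With \<open>K = (A - 1) / \<epsilon>\<close> this reads |y|^2 = K (A + 1), the
    source of both quadratic comparisons below.\<close>
  then have n2: "(norm y)\<^sup>2 = (A - 1) * (A + 1) / \<epsilon>" using e by (simp add: field_simps power2_eq_square)
  show "GDERIV (\<lambda>y. (sqrt (1 + \<epsilon> * (norm y)\<^sup>2) - 1) / \<epsilon>) y :> rel_vel \<epsilon> y"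
    unfolding gderiv_def power2_norm_eq_inner rel_vel_def
    using pos e by (auto intro!: derivative_eq_intros ext simp: inner_commute divide_simps)
  show "norm (rel_vel \<epsilon> x - rel_vel \<epsilon> y) \<le> norm (x - y)" by (rule rel_vel_nonexpansive[OF e(1)])
  show "\<exists>c. 0 \<le> c \<and> c \<le> 1 \<and> rel_vel \<epsilon> y = c *\<^sub>R y"
    using ge1 by (intro exI[of _ "1 / A"]) (simp add: rel_vel_def A_def)
  show "0 \<le> (sqrt (1 + \<epsilon> * (norm y)\<^sup>2) - 1) / \<epsilon>"
    using ge1 e by (simp flip: A_def)
  show "norm y \<le> (sqrt (1 + \<epsilon> * (norm y)\<^sup>2) - 1) / \<epsilon> + 2"
  proof (cases "norm y \<le> 2")
    case True
    then show ?thesis using ge1 e by (simp flip: A_def add: add_increasing)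
  next
    case False
    \<comment> \<open>Here \<epsilon> < 1 enters: after squaring, the claim is \<epsilon> (|y| -
      2)^2 + 2 (|y| - 2) \<le> |y|^2, and the coefficient \<epsilon> may be replaced by 1.\<close>
    have "1 + \<epsilon> * (norm y - 2) \<le> sqrt (1 + \<epsilon> * (norm y)\<^sup>2)"
    proof (rule real_le_rsqrt)
      have "\<epsilon> * (norm y - 2)\<^sup>2 \<le> 1 * (norm y - 2)\<^sup>2" using e by (intro mult_right_mono) auto
      also have "\<dots> \<le> (norm y)\<^sup>2 - 2 * (norm y - 2)" using False by (simp add: power2_eq_square algebra_simps)
      finally have "\<epsilon> * (\<epsilon> * (norm y - 2)\<^sup>2) \<le> \<epsilon> * ((norm y)\<^sup>2 - 2 * (norm y - 2))"
        using e by (intro mult_left_mono) auto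
      then show "(1 + \<epsilon> * (norm y - 2))\<^sup>2 \<le> 1 + \<epsilon> * (norm y)\<^sup>2"
        by (simp add: power2_eq_square algebra_simps)
    qed
    then show ?thesis using e by (simp add: field_simps)
  qed
  show "(norm (rel_vel \<epsilon> y))\<^sup>2 \<le> 2 * ((sqrt (1 + \<epsilon> * (norm y)\<^sup>2) - 1) / \<epsilon>)"
  proof -
    have "norm (rel_vel \<epsilon> y) = norm y / A" using ge1 by (simp add: rel_vel_def flip: A_def)
    then have "(norm (rel_vel \<epsilon> y))\<^sup>2 = (A - 1) / \<epsilon> * ((A + 1) / A\<^sup>2)" by (simp add: power_divide n2)
    also have "\<dots> \<le> (A - 1) / \<epsilon> * 2"
    proof (intro mult_left_mono)
      have "0 \<le> (A - 1) * (2 * A + 1)" using ge1 by (intro mult_nonneg_nonneg) auto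
      then have "A + 1 \<le> 2 * A\<^sup>2" by (simp add: algebra_simps power2_eq_square)
      then show "(A + 1) / A\<^sup>2 \<le> 2" using ge1 by (simp add: pos_divide_le_eq)
    qed (use ge1 e in auto)
    finally show ?thesis by (simp add: A_def mult.commute)
  qed
  show "(sqrt (1 + \<epsilon> * (norm y)\<^sup>2) - 1) / \<epsilon> \<le> (norm y)\<^sup>2"
  proof -
    have "(A - 1) / \<epsilon> * 1 \<le> (A - 1) / \<epsilon> * (A + 1)" using ge1 e by (intro mult_left_mono) auto
    then have "(A - 1) / \<epsilon> \<le> (norm y)\<^sup>2" by (simp add: n2)
    then show ?thesis by (simp add: A_def)
  qed
qed

section \<open>Pathwise stability\<close>

text \<open>Evaluate the inequality at a maximum point s of u weighted by exp(-2bt). The doubled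
  rate makes the integral term at most half of the left-hand side, so it can be absorbed; the price
  is the factor 2 and the doubled exponent.\<close>

lemma gronwall_crude:
  fixes u :: "real \<Rightarrow> real"
  assumes cont: "continuous_on {0..\<tau>} u" and b: "b > 0" and \<tau>: "0 \<le> \<tau>"
    and le: "\<And>t. t \<in> {0..\<tau>} \<Longrightarrow> u t \<le> a + b * integral {0..t} u"
    and t: "t \<in> {0..\<tau>}" and a: "a \<ge> 0"
  shows "u t \<le> 2 * a * exp (2 * b * \<tau>)"
proof -
  have "continuous_on {0..\<tau>} (\<lambda>t. u t * exp (- (2 * b * t)))"
    by (intro continuous_intros cont)
  from continuous_attains_sup[OF compact_Icc _ this] \<tau>
  obtain s where s: "s \<in> {0..\<tau>}" 
    and max: "\<And>t. t \<in> {0..\<tau>} \<Longrightarrow> u t * exp (- (2 * b * t)) \<le> u s * exp (- (2 * b * s))" by auto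
  define \<mu> where "\<mu> = u s * exp (- (2 * b * s))"
  have u_le: "u r \<le> \<mu> * exp (2 * b * r)" if "r \<in> {0..\<tau>}" for r
    using max[OF that] by (simp add: \<mu>_def exp_minus field_simps)
  have ie: "((\<lambda>r. \<mu> * exp (2 * b * r)) has_integral (\<mu> * exp (2 * b * s) / (2 * b) - \<mu> * exp (2 * b * 0) / (2 * b))) {0..s}"
    using s b by (intro fundamental_theorem_of_calculus)
      (auto intro!: derivative_eq_intros simp flip: has_real_derivative_iff_has_vector_derivative)
  have "\<mu> * exp (2 * b * s) = u s" by (simp add: \<mu>_def exp_minus)
  also have "\<dots> \<le> a + b * integral {0..s} u" by (rule le[OF s])
  also have "integral {0..s} u \<le> integral {0..s} (\<lambda>r. \<mu> * exp (2 * b * r))"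
    using s ie u_le by (intro integral_le integrable_continuous_real continuous_on_subset[OF cont])
      (auto intro!: continuous_intros)
  also have "\<dots> = (\<mu> * exp (2 * b * s) - \<mu>) / (2 * b)"
    using integral_unique[OF ie] by (simp add: diff_divide_distrib)
  finally have "\<mu> * exp (2 * b * s) \<le> a + b * ((\<mu> * exp (2 * b * s) - \<mu>) / (2 * b))"
    using b by simp
  also have "\<dots> = a + (\<mu> * exp (2 * b * s) - \<mu>) / 2" using b by simp
  finally have *: "\<mu> * (exp (2 * b * s) + 1) \<le> 2 * a" by (simp add: field_simps)
  have \<mu>: "\<mu> \<le> 2 * a"
  proof (cases "\<mu> \<le> 0")
    case False
    then have "\<mu> * 1 \<le> \<mu> * (exp (2 * b * s) + 1)" by (intro mult_left_mono) auto
    with * show ?thesis by simp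
  qed (use a in simp)
  have "u t \<le> \<mu> * exp (2 * b * t)" by (rule u_le[OF t])
  also have "\<dots> \<le> (2 * a) * exp (2 * b * \<tau>)"
    using \<mu> t b a by (intro mult_mono) auto
  finally show ?thesis .
qed

text \<open>The closed tube around the trajectory is written as a Minkowski sum of two compact sets
  and is thus compact; for small radius it stays inside the open set S.\<close>

lemma tube_lipschitz:
  fixes q :: "real \<Rightarrow> 'v::euclidean_space"
  assumes "loc_lip S F" "open S" "continuous_on {0..T} q" "\<And>t. t \<in> {0..T} \<Longrightarrow> q t \<in> S"
  obtains r L where "r > 0" "L \<ge> 0" 
    "\<And>t x. t \<in> {0..T} \<Longrightarrow> norm (x - q t) \<le> r \<Longrightarrow> norm (F x - F (q t)) \<le> L * norm (x - q t)"
proof -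
  have K: "compact (q ` {0..T})" by (intro compact_continuous_image assms compact_Icc)
  obtain r where r: "r > 0" "(\<Union>x\<in>q ` {0..T}. cball x r) \<subseteq> S"
    using compact_subset_open_imp_cball_epsilon_subset[OF K assms(2)] assms(4) by blast
  let ?X = "{x + y |x y. x \<in> q ` {0..T} \<and> y \<in> cball 0 r}"
  have "compact ?X" by (rule compact_sums[OF K compact_cball])
  moreover have XS: "?X \<subseteq> S" using r(2) by (force simp: dist_norm)
  ultimately obtain L where L: "L-lipschitz_on ?X F" using loc_lip_compact[OF assms(1)] by blast
  show thesis
  proof
    show "r > 0" "L \<ge> 0" using r L lipschitz_on_nonneg by auto
    fix t x assume t: "t \<in> {0..T}" and x: "norm (x - q t) \<le> r"
    have "x \<in> ?X" using t x by (intro CollectI exI[of _ "q t"] exI[of _ "x - q t"]) (auto simp: dist_norm norm_minus_commute)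
    moreover have "q t \<in> ?X" using t r by (intro CollectI exI[of _ "q t"] exI[of _ 0]) auto
    ultimately show "norm (F x - F (q t)) \<le> L * norm (x - q t)"
      using L by (auto simp: lipschitz_on_def dist_norm)
  qed
qed

definition path_sol :: "('v::euclidean_space \<Rightarrow> 'v) \<Rightarrow> ('v \<Rightarrow> 'v) \<Rightarrow> 'v set
    \<Rightarrow> (real \<Rightarrow> 'v) \<Rightarrow> 'v \<Rightarrow> 'v \<Rightarrow> (real \<Rightarrow> 'v) \<Rightarrow> (real \<Rightarrow> 'v) \<Rightarrow> bool" where
  "path_sol vel F S w q0 p0 q p \<longleftrightarrow> continuous_on {0..} q \<and> continuous_on {0..} p \<and>
     (\<forall>t\<ge>0. q t \<in> S \<and> q t = q0 + integral {0..t} (\<lambda>s. vel (p s))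
        \<and> p t = p0 + integral {0..t} (\<lambda>s. - vel (p s) - F (q s)) + sqrt 2 *\<^sub>R w t)"

lemma path_solD:
  assumes "path_sol vel F S w q0 p0 q p"
  shows "continuous_on {0..} q" "continuous_on {0..} p"
    and "0 \<le> t \<Longrightarrow> q t \<in> S"
    and "0 \<le> t \<Longrightarrow> q t = q0 + integral {0..t} (\<lambda>s. vel (p s))"
    and "0 \<le> t \<Longrightarrow> p t = p0 + integral {0..t} (\<lambda>s. - vel (p s) - F (q s)) + sqrt 2 *\<^sub>R w t"
  using assms unfolding path_sol_def by blast+

lemma solves_path_sol:
  assumes "solves M vel F S W q0 p0 q p"
  shows "AE \<omega> in M. path_sol vel F S (\<lambda>t. W t \<omega>) q0 p0 (\<lambda>t. q t \<omega>) (\<lambda>t. p t \<omega>)"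
proof -
  have c: "continuous_on {0..} (\<lambda>t. q t \<omega>) \<and> continuous_on {0..} (\<lambda>t. p t \<omega>)" if "\<omega> \<in> space M" for \<omega>
    using assms that unfolding solves_def by blast
  have "AE \<omega> in M. \<forall>t\<ge>0. q t \<omega> \<in> S \<and> q t \<omega> = q0 + integral {0..t} (\<lambda>s. vel (p s \<omega>))
      \<and> p t \<omega> = p0 + integral {0..t} (\<lambda>s. - vel (p s \<omega>) - F (q s \<omega>)) + sqrt 2 *\<^sub>R W t \<omega>"
    using assms unfolding solves_def by blast
  then show ?thesis
  proof (rule AE_mp, intro AE_I2 impI)
    fix \<omega> assume "\<omega> \<in> space M" and *: "\<forall>t\<ge>0. q t \<omega> \<in> S \<and> q t \<omega> = q0 + integral {0..t} (\<lambda>s. vel (p s \<omega>))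
      \<and> p t \<omega> = p0 + integral {0..t} (\<lambda>s. - vel (p s \<omega>) - F (q s \<omega>)) + sqrt 2 *\<^sub>R W t \<omega>"
    then show "path_sol vel F S (\<lambda>t. W t \<omega>) q0 p0 (\<lambda>t. q t \<omega>) (\<lambda>t. p t \<omega>)"
      unfolding path_sol_def using c by blast
  qed
qed

text \<open>The additive noise cancels in the difference. The velocity error is split at
  \<open>vel (p r)\<close>, so that the consistency error \<open>c\<close> involves only the
  reference path. The rate 2 + L counts the momentum difference once in each equation, plus the
  force. The Lipschitz bound is asked for along the two paths only, so the estimate can be used up
  to an exit time.\<close>

lemma path_sol_diff_bound:
  fixes q p :: "real \<Rightarrow> 'v::euclidean_space"
  assumes F: "continuous_on S F"
    and sol: "path_sol (\<lambda>x. x) F S w q0 p0 q p"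
    and sol': "path_sol vel F S w q0 p0 q' p'"
    and vel: "\<And>x y. norm (vel x - vel y) \<le> norm (x - y)"
    and c: "\<And>t. t \<in> {0..\<tau>} \<Longrightarrow> norm (vel (p t) - p t) \<le> c"
    and L: "L \<ge> 0" "\<And>t. t \<in> {0..\<tau>} \<Longrightarrow> norm (F (q' t) - F (q t)) \<le> L * norm (q' t - q t)"
    and \<tau>: "0 \<le> \<tau>"
    and t: "t \<in> {0..\<tau>}"
  shows "norm (q' t - q t) + norm (p' t - p t) \<le> 4 * c * \<tau> * exp (2 * (2 + L) * \<tau>)"
proof -
  let ?u = "\<lambda>t. norm (q' t - q t) + norm (p' t - p t)"
  have cont: "continuous_on {0..\<tau>} q" "continuous_on {0..\<tau>} p" "continuous_on {0..\<tau>} q'" "continuous_on {0..\<tau>} p'"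
    using path_solD(1,2)[OF sol] path_solD(1,2)[OF sol'] by (auto elim: continuous_on_subset)
  have cvel: "continuous_on A vel" for A
    by (rule lipschitz_on_continuous_on[of 1]) (auto intro!: lipschitz_onI vel simp: dist_norm)
  have c0: "c \<ge> 0" by (rule order_trans[OF norm_ge_zero c[of 0]]) (use \<tau> in simp)
  have cu: "continuous_on {0..\<tau>} ?u" by (intro continuous_intros cont)
  have cF: "continuous_on {0..\<tau>} (\<lambda>t. F (q t))" "continuous_on {0..\<tau>} (\<lambda>t. F (q' t))"
    using path_solD(3)[OF sol] path_solD(3)[OF sol'] by (auto intro!: continuous_on_compose2[OF F] cont)
  have cv: "continuous_on {0..\<tau>} (\<lambda>t. vel (p' t))" "continuous_on {0..\<tau>} (\<lambda>t. vel (p t))"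
    by (auto intro!: continuous_on_compose2[OF cvel[of UNIV]] cont)
  have "?u s \<le> 2 * c * \<tau> + (2 + L) * integral {0..s} ?u" if s: "s \<in> {0..\<tau>}" for s
  proof -
    have sub: "{0..s} \<subseteq> {0..\<tau>}" using s by auto
    note io = integrable_continuous_real continuous_intros
    note cs = cont[THEN continuous_on_subset, OF sub] cF[THEN continuous_on_subset, OF sub]
       cv[THEN continuous_on_subset, OF sub] cu[THEN continuous_on_subset, OF sub]
    have v: "norm (vel (p' r) - p r) \<le> norm (p' r - p r) + c" if "r \<in> {0..s}" for r
    proof -
      have "norm (vel (p' r) - p r) \<le> norm (vel (p' r) - vel (p r)) + norm (vel (p r) - p r)"
        using norm_triangle_ineq[of "vel (p' r) - vel (p r)" "vel (p r) - p r"] by simp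
      then show ?thesis using vel[of "p' r" "p r"] c[of r] that sub by force
    qed
    have s0: "0 \<le> s" using s by simp
    have "q' s - q s = integral {0..s} (\<lambda>r. vel (p' r) - p r)"
      unfolding path_solD(4)[OF sol s0] path_solD(4)[OF sol' s0]
      by (subst integral_diff) (auto intro!: io cs)
    moreover have "norm \<dots> \<le> integral {0..s} (\<lambda>r. norm (p' r - p r) + c)"
      by (rule integral_norm_bound_integral) (auto intro!: io cs v simp del: atLeastAtMost_iff)
    ultimately have 1: "norm (q' s - q s) \<le> integral {0..s} (\<lambda>r. norm (p' r - p r) + c)" by simp
    have "p' s - p s = integral {0..s} (\<lambda>r. (- vel (p' r) - F (q' r)) - (- p r - F (q r)))"
      by (subst path_solD(5)[OF sol s0], subst path_solD(5)[OF sol' s0], subst integral_diff)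
        (auto intro!: io cs)
    moreover have "norm \<dots> \<le> integral {0..s} (\<lambda>r. norm (p' r - p r) + c + L * norm (q' r - q r))"
    proof (rule integral_norm_bound_integral)
      fix r assume r: "r \<in> {0..s}"
      have "norm ((- vel (p' r) - F (q' r)) - (- p r - F (q r))) \<le> norm (vel (p' r) - p r) + norm (F (q' r) - F (q r))"
        using norm_triangle_ineq4[of "- (vel (p' r) - p r)" "F (q' r) - F (q r)"]
        by (simp add: algebra_simps norm_minus_commute)
      then show "norm ((- vel (p' r) - F (q' r)) - (- p r - F (q r))) \<le> norm (p' r - p r) + c + L * norm (q' r - q r)"
        using v[OF r] L(2)[of r] r sub by force
    qed (auto intro!: io cs)
    ultimately have 2: "norm (p' s - p s) \<le> integral {0..s} (\<lambda>r. norm (p' r - p r) + c + L * norm (q' r - q r))" by simp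
    have "?u s \<le> integral {0..s} (\<lambda>r. norm (p' r - p r) + c + (norm (p' r - p r) + c + L * norm (q' r - q r)))"
      using 1 2 by (subst integral_add) (auto intro!: io cs)
    also have "\<dots> \<le> integral {0..s} (\<lambda>r. 2 * c + (2 + L) * ?u r)"
      using L(1) by (intro integral_le) (auto intro!: io cs simp: algebra_simps)
    also have "\<dots> = 2 * c * s + (2 + L) * integral {0..s} ?u"
    proof (subst integral_add)
      show "integral {0..s} (\<lambda>r. 2 * c) + integral {0..s} (\<lambda>r. (2 + L) * ?u r) = 2 * c * s + (2 + L) * integral {0..s} ?u"
        using s by simp
    qed (auto intro!: io cs)
    also have "\<dots> \<le> 2 * c * \<tau> + (2 + L) * integral {0..s} ?u" using s c0 by (intro add_right_mono mult_left_mono) auto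
    finally show ?thesis .
  qed
  from gronwall_crude[OF cu _ \<tau> this t] L(1) c0 \<tau> show ?thesis by (simp add: mult_ac)
qed

lemma path_sol_initial:
  assumes "path_sol vel F S w q0 p0 q p" "w 0 = 0"
  shows "q 0 = q0" "p 0 = p0"
  using path_solD(4,5)[OF assms(1), of 0] assms(2) by simp_all

text \<open>A continuation argument: while the distance is at most \<rho>, both paths lie in the
  tube where the force is Lipschitz, and Gronwall improves the bound to D \<epsilon>, strictly below
  \<rho>. The threshold for \<epsilon> depends only on the limiting path, so it serves every
  solution of the perturbed system.\<close>

lemma path_sol_stable:
  fixes q p :: "real \<Rightarrow> 'v::euclidean_space"
  assumes S: "open S" and F: "loc_lip S F" and w0: "w 0 = 0" and T: "T \<ge> 0" and \<xi>: "\<xi> > 0"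
    and sol: "path_sol (\<lambda>x. x) F S w q0 p0 q p"
    and vel: "\<And>\<epsilon> x y. \<epsilon> \<in> {0<..<1} \<Longrightarrow> norm (vel \<epsilon> x - vel \<epsilon> y) \<le> norm (x - y)"
    and vel_id: "\<And>\<epsilon> x. \<epsilon> \<in> {0<..<1} \<Longrightarrow> norm (vel \<epsilon> x - x) \<le> C * \<epsilon> * norm x ^ 3"
  shows "\<exists>\<delta>>0. \<forall>\<epsilon> q' p'. 0 < \<epsilon> \<longrightarrow> \<epsilon> < \<delta> \<longrightarrow> \<epsilon> < 1 \<longrightarrow> path_sol (vel \<epsilon>) F S w q0 p0 q' p' \<longrightarrow>
     (\<forall>t\<in>{0..T}. norm (q' t - q t) + norm (p' t - p t) < \<xi>)"
proof -
  have cont: "continuous_on {0..T} q" "continuous_on {0..T} p" and qS: "\<And>t. t \<in> {0..T} \<Longrightarrow> q t \<in> S"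
    using path_solD(1-3)[OF sol] by (auto elim: continuous_on_subset)
  obtain r L where r: "r > 0" and L: "L \<ge> 0"
    "\<And>t x. t \<in> {0..T} \<Longrightarrow> norm (x - q t) \<le> r \<Longrightarrow> norm (F x - F (q t)) \<le> L * norm (x - q t)"
    using tube_lipschitz[OF F S cont(1) qS] by metis
  have "bounded (p ` {0..T})" by (intro compact_imp_bounded compact_continuous_image cont compact_Icc)
  then obtain B where B: "B > 0" "\<And>t. t \<in> {0..T} \<Longrightarrow> norm (p t) \<le> B" by (auto simp: bounded_pos)
  define D where "D = 4 * (\<bar>C\<bar> * B ^ 3) * T * exp (2 * (2 + L) * T)"
  have D: "D \<ge> 0" using B T by (auto simp: D_def)
  define \<rho> where "\<rho> = min r \<xi>"
  have \<rho>: "\<rho> > 0" using r \<xi> by (simp add: \<rho>_def)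
  \<comment> \<open>The summand 1 covers D = 0 and makes \<open>D * \<delta>\<close> strictly
    smaller than \<rho>.\<close>
  define \<delta> where "\<delta> = \<rho> / (D + 1)"
  show ?thesis
  proof (intro exI[of _ \<delta>] conjI allI impI ballI)
    show "\<delta> > 0" using \<rho> D by (simp add: \<delta>_def)
    fix \<epsilon> q' p' t assume e: "0 < \<epsilon>" "\<epsilon> < \<delta>" "\<epsilon> < 1" and sol': "path_sol (vel \<epsilon>) F S w q0 p0 q' p'"
      and t: "t \<in> {0..T}"
    let ?u = "\<lambda>t. norm (q' t - q t) + norm (p' t - p t)"
    have small: "D * \<epsilon> < \<rho>"
    proof -
      have "D * \<epsilon> \<le> D * \<delta>" using D e by (intro mult_left_mono) auto
      also have "\<dots> < \<rho>" using D \<rho> by (simp add: \<delta>_def field_simps)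
      finally show ?thesis .
    qed
    have cu: "continuous_on {0..T} ?u"
      by (intro continuous_intros cont) (use path_solD(1,2)[OF sol'] in \<open>auto elim: continuous_on_subset\<close>)
    have est: "?u s < \<rho>" if s: "s \<in> {0..T}" and small_before: "\<And>r. r \<in> {0..s} \<Longrightarrow> ?u r \<le> \<rho>" for s
    proof -
      have "?u s \<le> 4 * (\<bar>C\<bar> * \<epsilon> * B ^ 3) * s * exp (2 * (2 + L) * s)"
      proof (rule path_sol_diff_bound[OF loc_lip_continuous_on[OF F S] sol sol'])
        show "norm (vel \<epsilon> x - vel \<epsilon> y) \<le> norm (x - y)" for x y using vel e by simp
        show "norm (vel \<epsilon> (p t) - p t) \<le> \<bar>C\<bar> * \<epsilon> * B ^ 3" if "t \<in> {0..s}" for t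
        proof -
          have "norm (vel \<epsilon> (p t) - p t) \<le> C * \<epsilon> * norm (p t) ^ 3" using vel_id e by simp
          also have "\<dots> \<le> \<bar>C\<bar> * \<epsilon> * B ^ 3"
            using e B(2)[of t] that s by (intro mult_mono power_mono) auto
          finally show ?thesis .
        qed
        show "norm (F (q' t) - F (q t)) \<le> L * norm (q' t - q t)" if "t \<in> {0..s}" for t
        proof (rule L(2))
          show "t \<in> {0..T}" using that s by auto
          have "?u t \<le> r" using small_before[OF that] by (simp add: \<rho>_def)
          then show "norm (q' t - q t) \<le> r" by (rule order_trans[rotated]) simp
        qed
      qed (use L s in auto)
      also have "\<dots> \<le> 4 * (\<bar>C\<bar> * \<epsilon> * B ^ 3) * T * exp (2 * (2 + L) * T)"
        using s L B e by (intro mult_mono) auto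
      also have "\<dots> = D * \<epsilon>" by (simp add: D_def)
      finally show ?thesis using small by simp
    qed
    have "?u t < \<rho>"
    proof (rule ccontr)
      assume n: "\<not> ?u t < \<rho>"
      let ?A = "{s \<in> {0..T}. \<rho> \<le> ?u s}"
      have "closed ?A" 
        using continuous_closed_preimage[OF cu closed_atLeastAtMost closed_atLeast[of \<rho>]]
        by (simp add: vimage_def Int_def)
      then have "compact ?A"
        by (auto simp: compact_eq_bounded_closed intro: bounded_subset[OF bounded_closed_interval[of 0 T]])
      moreover have "t \<in> ?A" using n t by auto
      ultimately obtain s where s: "s \<in> ?A" "\<And>s'. s' \<in> ?A \<Longrightarrow> s \<le> s'"
        using compact_attains_inf[of ?A] by blast
      \<comment> \<open>s is the first time at which the distance reaches \<rho>. Starting from 0 it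
        takes the value \<rho> exactly by the intermediate value theorem, so the hypothesis of
        \<open>est\<close> holds on the closed interval, endpoint included.\<close>
      have before: "?u r \<le> \<rho>" if r: "r \<in> {0..s}" for r
      proof (cases "r = s")
        case False
        then have "r \<notin> ?A" using s(2) r by force
        then show ?thesis using r s(1) by auto
      next
        case True
        have u0: "?u 0 = 0" using path_sol_initial[OF sol w0] path_sol_initial[OF sol' w0] by simp
        obtain x where x: "0 \<le> x" "x \<le> s" "?u x = \<rho>"
          using IVT'[of ?u 0 \<rho> s] u0 s(1) \<rho> continuous_on_subset[OF cu, of "{0..s}"] by auto
        with s have "x = s" by force
        then show ?thesis using x True by simp
      qed
      have "?u s < \<rho>" using s(1) before by (intro est) auto
      then show False using s(1) by simp
    qed
    then show "?u t < \<xi>" by (simp add: \<rho>_def)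
  qed
qed

section \<open>A priori bound for one particle\<close>

locale singular_potential =
  fixes U :: "'v::euclidean_space \<Rightarrow> real" and gradU :: "'v \<Rightarrow> 'v"
    and G :: "'v \<Rightarrow> real" and gradG :: "'v \<Rightarrow> 'v"
    and a1 lam \<beta>1 \<beta>2 a4 a5 a6 :: real
  assumes U_ge1: "U q \<ge> 1"
    and U_grad: "GDERIV U q :> gradU q"
    and a1_pos: "a1 > 0" and lam_ge1: "lam \<ge> 1"
    and U_lower: "(1 / a1) * norm q powr (lam + 1) - a1 \<le> U q"
    and gradU_bound: "norm (gradU q) \<le> a1 * (1 + norm q powr lam)"
    and G_grad: "q \<noteq> 0 \<Longrightarrow> GDERIV G q :> gradG q"
    and G_sing: "filterlim G at_top (at 0)"
    and beta1: "\<beta>1 \<ge> 1"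
    and G_bound: "q \<noteq> 0 \<Longrightarrow> \<bar>G q\<bar> \<le> a1 * (1 + norm q + norm q powr (- \<beta>1))"
    and gradG_bound: "q \<noteq> 0 \<Longrightarrow> norm (gradG q) \<le> a1 * (1 + norm q powr (- \<beta>1))"
    and beta2: "0 \<le> \<beta>2" "\<beta>2 < \<beta>1" and a4_pos: "a4 > 0"
    and gradG_asym: "q \<noteq> 0 \<Longrightarrow>
        norm (gradG q + (a4 / norm q powr (\<beta>1 + 1)) *\<^sub>R q + (a5 / norm q powr (\<beta>2 + 1)) *\<^sub>R q) \<le> a6"
begin

lemma powr_lam_le: "norm q powr (lam + 1) \<le> a1 * (U q + a1)"
  using U_lower[of q] a1_pos by (simp add: field_simps)

text \<open>This is where \<lambda> + 1 \<ge> 2 is used. Quadratic confinement absorbs the linear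
  growth that G may have at infinity.\<close>

lemma norm_sq_le: "(norm q)\<^sup>2 \<le> 1 + a1 * (U q + a1)"
proof (cases "norm q \<le> 1")
  case True
  then have "(norm q)\<^sup>2 \<le> 1" by (simp add: power_le_one)
  then show ?thesis using a1_pos U_ge1[of q] by (simp add: add_increasing2)
next
  case False
  then have "(norm q)\<^sup>2 = norm q powr 2" by simp
  also have "\<dots> \<le> norm q powr (lam + 1)" using False lam_ge1 by (intro powr_mono) auto
  finally show ?thesis using powr_lam_le[of q] by simp
qed

lemma norm_le_U: "norm q \<le> 1 + a1 * (U q + a1)"
proof -
  have "norm q \<le> 1 \<or> norm q \<le> (norm q)\<^sup>2" using mult_right_mono[of 1 "norm q" "norm q"] unfolding power2_eq_square by linarith
  moreover have "1 \<le> 1 + a1 * (U q + a1)" using a1_pos U_ge1[of q] by simp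
  ultimately show ?thesis using norm_sq_le[of q] by linarith
qed

text \<open>Bounding the force by the potential itself lets the energy estimate close in one scalar.
  The lower bound \<open>U_ge1\<close> allows additive constants to be written as multiples of
  U.\<close>

lemma gradU_le_U: "norm (gradU q) \<le> (a1 * (2 + a1 + a1 * a1)) * U q"
proof -
  have "norm q powr lam \<le> 1 + norm q powr (lam + 1)"
  proof (cases "norm q \<le> 1")
    case True
    then have "norm q powr lam \<le> 1 powr lam" using lam_ge1 by (intro powr_mono2) auto
    then show ?thesis by (simp add: add_increasing2)
  next
    case False
    then have "norm q powr lam \<le> norm q powr (lam + 1)" by (intro powr_mono) auto
    then show ?thesis by simp
  qed
  then have "norm q powr lam \<le> 1 + a1 * (U q + a1)" using powr_lam_le[of q] by simp
  also have "\<dots> \<le> U q + a1 * (U q + a1 * U q)" 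
    using U_ge1[of q] a1_pos by (intro add_mono mult_left_mono) auto
  finally have "1 + norm q powr lam \<le> (2 + a1 + a1 * a1) * U q"
    using U_ge1[of q] by (simp add: algebra_simps)
  then have "a1 * (1 + norm q powr lam) \<le> a1 * ((2 + a1 + a1 * a1) * U q)"
    using a1_pos by (intro mult_left_mono) auto
  then show ?thesis using gradU_bound[of q] by (simp add: mult.assoc)
qed

text \<open>Close to the origin G is nonnegative because it diverges to plus infinity. Elsewhere -G
  grows at most linearly, and the square is completed with the weight 1/(2 a1) so that
  \<open>norm_sq_le\<close> consumes exactly half of U.\<close>

lemma potential_lower: "\<exists>C. \<forall>q. q \<noteq> 0 \<longrightarrow> U q / 2 - C \<le> U q + G q"
proof -
  have "eventually (\<lambda>q. 0 \<le> G q) (at 0)" using G_sing unfolding filterlim_at_top by blast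
  then obtain r where r: "r > 0" "\<And>q. q \<noteq> 0 \<Longrightarrow> dist q 0 < r \<Longrightarrow> 0 \<le> G q"
    unfolding eventually_at by auto
  define C where "C = a1 * (1 + r powr (- \<beta>1)) + a1 ^ 3 / 2 + 1 / (2 * a1) + a1 / 2"
  have C0: "0 \<le> C" using a1_pos by (simp add: C_def)
  have "U q / 2 - C \<le> U q + G q" if q: "q \<noteq> 0" for q
  proof (cases "norm q < r")
    case True
    then show ?thesis using r(2)[OF q] U_ge1[of q] C0 by simp
  next
    case False
    have "norm q powr (- \<beta>1) \<le> r powr (- \<beta>1)"
      using False r beta1 by (intro powr_mono2') auto
    then have "a1 * (1 + norm q + norm q powr (- \<beta>1)) \<le> a1 * (1 + norm q + r powr (- \<beta>1))"
      using a1_pos by (intro mult_left_mono) auto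
    then have 1: "- G q \<le> a1 * (1 + r powr (- \<beta>1)) + a1 * norm q"
      using G_bound[OF q] by (simp add: algebra_simps)
    have "a1 * norm q \<le> (norm q)\<^sup>2 / (2 * a1) + a1 ^ 3 / 2"
    proof -
      have "0 \<le> (norm q - a1\<^sup>2)\<^sup>2 / (2 * a1)" using a1_pos by simp
      also have "\<dots> = (norm q)\<^sup>2 / (2 * a1) + a1 ^ 3 / 2 - a1 * norm q"
        using a1_pos by (simp add: power2_eq_square power3_eq_cube field_simps)
      finally show ?thesis by simp
    qed
    also have "(norm q)\<^sup>2 / (2 * a1) \<le> (1 + a1 * (U q + a1)) / (2 * a1)"
      using norm_sq_le[of q] a1_pos by (intro divide_right_mono) auto
    also have "\<dots> = 1 / (2 * a1) + U q / 2 + a1 / 2" using a1_pos by (simp add: field_simps)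
    finally show ?thesis using 1 unfolding C_def by linarith
  qed
  then show ?thesis by blast
qed

text \<open>Here \<beta>1 \<ge> 1 is used: rotation of the direction of q costs a term of order
  1/|q|, and this makes it payable by the repulsion.\<close>

lemma inverse_norm_le: "q \<noteq> 0 \<Longrightarrow> 1 / norm q \<le> 1 + norm (q::'v) powr (- \<beta>1)"
proof (cases "norm q \<ge> 1")
  case False
  assume q: "q \<noteq> 0"
  have "1 / norm q = norm q powr (-1)" using q by (simp add: powr_minus_divide)
  also have "\<dots> \<le> norm q powr (- \<beta>1)" using q False beta1 by (intro powr_mono') auto
  finally show ?thesis by simp
qed (simp add: add_increasing2)

text \<open>The leading term of the asymptotics pushes outward with strength
  \<open>a4 * norm q powr (- \<beta>1)\<close>. The term of lower order \<beta>2 may have either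
  sign; within radius r it costs at most a quarter of the leading term, and outside it is
  bounded.\<close>

lemma repulsion: "\<exists>C\<ge>0. \<forall>q. q \<noteq> 0 \<longrightarrow> 3 / 4 * a4 * norm q powr (- \<beta>1) - C \<le> - (gradG q \<bullet> sgn q)"
proof -
  \<comment> \<open>Chosen so that
    \<open>\<bar>a5\<bar> * r powr (\<beta>1 - \<beta>2) \<le> a4 / 4\<close>; the summand 1 avoids
    dividing by zero when a5 = 0.\<close>
  define r where "r = min 1 ((a4 / (4 * (\<bar>a5\<bar> + 1))) powr (1 / (\<beta>1 - \<beta>2)))"
  have r: "0 < r" "r \<le> 1" using a4_pos by (auto simp: r_def)
  have rp: "\<bar>a5\<bar> * r powr (\<beta>1 - \<beta>2) \<le> a4 / 4"
  proof -
    have "r powr (\<beta>1 - \<beta>2) \<le> ((a4 / (4 * (\<bar>a5\<bar> + 1))) powr (1 / (\<beta>1 - \<beta>2))) powr (\<beta>1 - \<beta>2)"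
      using beta2 r by (intro powr_mono2) (auto simp: r_def)
    also have "\<dots> = a4 / (4 * (\<bar>a5\<bar> + 1))" using beta2 a4_pos by (simp add: powr_powr)
    finally have "\<bar>a5\<bar> * r powr (\<beta>1 - \<beta>2) \<le> \<bar>a5\<bar> * (a4 / (4 * (\<bar>a5\<bar> + 1)))"
      by (intro mult_left_mono) auto
    also have "\<dots> \<le> a4 / 4" using a4_pos by (simp add: field_simps)
    finally show ?thesis .
  qed
  define C where "C = \<bar>a6\<bar> + \<bar>a5\<bar> * r powr (- \<beta>2)"
  have "3 / 4 * a4 * norm q powr (- \<beta>1) - C \<le> - (gradG q \<bullet> sgn q)" if q: "q \<noteq> 0" for q
  proof -
    define x where "x = norm q powr (- \<beta>1)"
    have qs: "(q /\<^sub>R norm q powr (b + 1)) \<bullet> sgn q = norm q powr (- b)" for b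
      using q by (simp add: sgn_div_norm powr_add powr_minus field_simps flip: power2_norm_eq_inner)
        (simp add: power2_eq_square)
    let ?R = "gradG q + (a4 / norm q powr (\<beta>1 + 1)) *\<^sub>R q + (a5 / norm q powr (\<beta>2 + 1)) *\<^sub>R q"
    have "?R \<bullet> sgn q = gradG q \<bullet> sgn q + a4 * x + a5 * norm q powr (- \<beta>2)"
      using qs[of \<beta>1] qs[of \<beta>2] by (simp add: inner_add_left x_def divide_inverse mult.assoc)
    moreover have "?R \<bullet> sgn q \<le> \<bar>a6\<bar>"
    proof -
      have "?R \<bullet> sgn q \<le> norm ?R * norm (sgn q)" by (rule norm_cauchy_schwarz)
      then show ?thesis using gradG_asym[OF q] q by (simp add: norm_sgn)
    qed
    moreover have "\<bar>a5\<bar> * norm q powr (- \<beta>2) \<le> a4 / 4 * x + \<bar>a5\<bar> * r powr (- \<beta>2)"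
    proof (cases "norm q \<le> r")
      case True
      have "norm q powr (- \<beta>2) = norm q powr (\<beta>1 - \<beta>2) * x" using q by (simp add: x_def flip: powr_add)
      also have "\<dots> \<le> r powr (\<beta>1 - \<beta>2) * x" using True beta2 by (intro mult_right_mono powr_mono2) (auto simp: x_def)
      finally have "\<bar>a5\<bar> * norm q powr (- \<beta>2) \<le> (\<bar>a5\<bar> * r powr (\<beta>1 - \<beta>2)) * x"
        by (simp add: mult_left_mono mult.assoc)
      also have "\<dots> \<le> a4 / 4 * x" using rp by (intro mult_right_mono) (auto simp: x_def)
      finally show ?thesis by (simp add: add_increasing2)
    next
      case False
      then have "norm q powr (- \<beta>2) \<le> r powr (- \<beta>2)" using r beta2 by (intro powr_mono2') auto
      then have "\<bar>a5\<bar> * norm q powr (- \<beta>2) \<le> \<bar>a5\<bar> * r powr (- \<beta>2)" by (intro mult_left_mono) auto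
      then show ?thesis using a4_pos by (simp add: x_def add_increasing)
    qed
    moreover have "- (a5 * norm q powr (- \<beta>2)) \<le> \<bar>a5\<bar> * norm q powr (- \<beta>2)"
      using mult_right_mono[of "-a5" "\<bar>a5\<bar>" "norm q powr (- \<beta>2)"] by simp
    ultimately show ?thesis unfolding C_def x_def[symmetric] by linarith
  qed
  moreover have "C \<ge> 0" by (simp add: C_def)
  ultimately show ?thesis by blast
qed

end

section \<open>Energy and radial momentum along a perturbed trajectory\<close>

lemma GDERIV_chain_curve:
  assumes K: "GDERIV K (y t) :> g" and y: "(y has_vector_derivative y') (at t within X)"
  shows "((\<lambda>s. K (y s)) has_real_derivative (y' \<bullet> g)) (at t within X)"
proof -
  have "((\<lambda>s. K (y s)) has_derivative (\<lambda>s. (s *\<^sub>R y') \<bullet> g)) (at t within X)"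
    using has_derivative_compose[OF y[unfolded has_vector_derivative_def] K[unfolded gderiv_def]] .
  then show ?thesis
    unfolding has_field_derivative_def by (rule has_derivative_eq_rhs) (simp add: fun_eq_iff)
qed

text \<open>The velocity \<open>v\<close> belongs to the smoothed momentum, whereas q moves with the
  true velocity \<open>v'\<close>. The potential forces therefore do not cancel completely but act
  on the mismatch \<open>v' - v\<close>.\<close>

lemma energy_derivative:
  fixes y q :: "real \<Rightarrow> 'v::euclidean_space"
  assumes "GDERIV K (y t) :> v" "GDERIV U (q t) :> gU" "GDERIV G (q t) :> gG"
    and q: "(q has_vector_derivative v') (at t within X)"
    and y: "(y has_vector_derivative (- v' - gU - gG + f)) (at t within X)"
  shows "((\<lambda>s. K (y s) + U (q s) + G (q s)) has_real_derivative
     (- (v \<bullet> v') + v \<bullet> f + (gU + gG) \<bullet> (v' - v))) (at t within X)"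
  by (rule derivative_eq_intros GDERIV_chain_curve[OF _ q] GDERIV_chain_curve[OF _ y] assms refl)+
    (simp add: inner_diff inner_add algebra_simps inner_commute)

text \<open>The quotient by \<open>norm (q t)\<close> is the effect of the rotating unit vector: it
  pairs y with the component of q' orthogonal to q.\<close>

lemma radial_derivative:
  fixes y q :: "real \<Rightarrow> 'v::euclidean_space"
  assumes q0: "q t \<noteq> 0"
    and q: "(q has_vector_derivative q') (at t within X)"
    and y: "(y has_vector_derivative y') (at t within X)"
  shows "((\<lambda>s. (y s \<bullet> q s) / norm (q s)) has_real_derivative
     (y' \<bullet> sgn (q t) + (y t \<bullet> q' - (y t \<bullet> sgn (q t)) * (q' \<bullet> sgn (q t))) / norm (q t))) (at t within X)"
proof -
  have 1: "((\<lambda>s. norm (q s)) has_real_derivative (q' \<bullet> sgn (q t))) (at t within X)"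
    by (rule GDERIV_chain_curve[OF GDERIV_norm[OF q0] q])
  have "((\<lambda>s. y s \<bullet> q s) has_derivative (\<lambda>h. y t \<bullet> (h *\<^sub>R q') + (h *\<^sub>R y') \<bullet> q t)) (at t within X)"
    using has_derivative_inner[OF y[unfolded has_vector_derivative_def] q[unfolded has_vector_derivative_def]] .
  then have 2: "((\<lambda>s. y s \<bullet> q s) has_real_derivative (y t \<bullet> q' + y' \<bullet> q t)) (at t within X)"
    unfolding has_field_derivative_def by (rule has_derivative_eq_rhs) (simp add: fun_eq_iff algebra_simps)
  have qs: "q t = norm (q t) *\<^sub>R sgn (q t)" using q0 by (simp add: sgn_div_norm)
  have i: "x \<bullet> q t = norm (q t) * (x \<bullet> sgn (q t))" for x by (subst qs) (rule inner_scaleR_right)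
  show ?thesis
    by (rule derivative_eq_intros 1 2 refl)+ (use q0 in \<open>simp_all add: i field_simps power2_eq_square\<close>)
qed

text \<open>The tangential part u of y enters as \<open>|u|\<^sup>2 + \<langle>u, h\<rangle> \<ge> -|h|\<^sup>2/4\<close>, so rotation of \<open>q/|q|\<close> can
  only decrease the radial momentum at a small rate, however fast it is.\<close>
lemma angular_bound:
  fixes y h e :: "'v::euclidean_space"
  assumes e: "norm e = 1" and c: "0 \<le> c" "c \<le> 1" and h: "norm h \<le> \<eta>"
  shows "- (\<eta>\<^sup>2 / 4) \<le> y \<bullet> (c *\<^sub>R (y + h)) - (y \<bullet> e) * ((c *\<^sub>R (y + h)) \<bullet> e)"
proof -
  define u where "u = y - (y \<bullet> e) *\<^sub>R e"
  have ee: "e \<bullet> e = 1" using e by (simp flip: power2_norm_eq_inner)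
  have "0 \<le> (norm (u + (1/2) *\<^sub>R h))\<^sup>2" by simp
  also have "\<dots> = u \<bullet> u + u \<bullet> h + (norm h)\<^sup>2 / 4"
    by (simp add: power2_norm_eq_inner inner_add inner_commute)
  also have "\<dots> \<le> u \<bullet> u + u \<bullet> h + \<eta>\<^sup>2 / 4" using power_mono[OF h norm_ge_zero, of 2] by simp
  finally have 1: "- (\<eta>\<^sup>2 / 4) \<le> u \<bullet> u + u \<bullet> h" by simp
  have "- (\<eta>\<^sup>2 / 4) \<le> c * - (\<eta>\<^sup>2 / 4)" using c mult_right_mono[of c 1 "\<eta>\<^sup>2 / 4"] by simp
  also have "\<dots> \<le> c * (u \<bullet> u + u \<bullet> h)" using c 1 by (intro mult_left_mono) auto
  also have "\<dots> = y \<bullet> (c *\<^sub>R (y + h)) - (y \<bullet> e) * ((c *\<^sub>R (y + h)) \<bullet> e)"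
    using ee by (simp add: u_def inner_add inner_diff algebra_simps inner_commute)
  finally show ?thesis .
qed

text \<open>Polarization. Friction at the mismatched velocities can add energy only at a rate
  quadratic in the mismatch.\<close>

lemma neg_inner_le_quarter: "- (a \<bullet> b) \<le> (norm (b - a))\<^sup>2 / 4" for a b :: "'v::real_inner"
proof -
  have "0 \<le> (norm (a + b))\<^sup>2" by simp
  then show ?thesis by (simp add: power2_norm_eq_inner inner_add inner_diff inner_commute)
qed

context singular_potential
begin

text \<open>S stands for a bound on both kinetic energy and U. The potential forces enter only
  through the velocity mismatch, so they carry a factor \<eta>; the single term that is singular in
  q is \<eta> a1 |q|^(-\<beta>1).\<close>

lemma energy_rate:
  assumes v: "norm (v' - v) \<le> \<eta>" and \<eta>: "0 \<le> \<eta>" "\<eta> \<le> 1" and vS: "(norm v)\<^sup>2 \<le> 2 * S"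
    and f: "norm f \<le> L" and US: "U q \<le> S" and q: "q \<noteq> 0"
  shows "- (v \<bullet> v') + v \<bullet> f + (gradU q + gradG q) \<bullet> (v' - v)
    \<le> 1 + L * sqrt (2 * S) + \<eta> * (a1 * (2 + a1 + a1 * a1)) * S + \<eta> * a1 * (1 + norm q powr (- \<beta>1))"
proof -
  have "- (v \<bullet> v') \<le> \<eta>\<^sup>2 / 4" using neg_inner_le_quarter[of v v'] power_mono[OF v norm_ge_zero, of 2] by simp
  moreover have "\<eta>\<^sup>2 \<le> 1" using \<eta> by (simp add: power_le_one)
  moreover have "v \<bullet> f \<le> sqrt (2 * S) * L"
  proof -
    have "v \<bullet> f \<le> norm v * norm f" by (rule norm_cauchy_schwarz)
    also have "\<dots> \<le> sqrt (2 * S) * L" using f real_le_rsqrt[OF vS] order_trans[OF zero_le_power2 vS] by (intro mult_mono) auto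
    finally show ?thesis .
  qed
  moreover have "gradU q \<bullet> (v' - v) \<le> ((a1 * (2 + a1 + a1 * a1)) * S) * \<eta>"
  proof -
    have "gradU q \<bullet> (v' - v) \<le> norm (gradU q) * norm (v' - v)" by (rule norm_cauchy_schwarz)
    also have "\<dots> \<le> ((a1 * (2 + a1 + a1 * a1)) * S) * \<eta>"
    proof (rule mult_mono)
      show "norm (gradU q) \<le> a1 * (2 + a1 + a1 * a1) * S"
        by (rule order_trans[OF gradU_le_U mult_left_mono[OF US]]) (use a1_pos in simp)
      then show "0 \<le> a1 * (2 + a1 + a1 * a1) * S" by (rule order_trans[OF norm_ge_zero])
    qed (use v in auto)
    finally show ?thesis .
  qed
  moreover have "gradG q \<bullet> (v' - v) \<le> (a1 * (1 + norm q powr (- \<beta>1))) * \<eta>"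
  proof -
    have "gradG q \<bullet> (v' - v) \<le> norm (gradG q) * norm (v' - v)" by (rule norm_cauchy_schwarz)
    also have "\<dots> \<le> (a1 * (1 + norm q powr (- \<beta>1))) * \<eta>"
      using gradG_bound[OF q] v a1_pos by (intro mult_mono) auto
    finally show ?thesis .
  qed
  ultimately show ?thesis unfolding inner_add_left by (simp add: mult_ac)
qed

text \<open>Of the three quarters of \<open>a4\<close> left by \<open>repulsion\<close>, one more
  pays for the rotation, by \<open>\<eta>\<^sup>2 \<le> a4\<close> and
  \<open>inverse_norm_le\<close>. Half of \<open>a4\<close> remains as the coefficient of the
  singular gain.\<close>

lemma radial_rate:
  assumes C: "3 / 4 * a4 * norm q powr (- \<beta>1) - C \<le> - (gradG q \<bullet> sgn q)"
    and c: "0 \<le> c" "c \<le> 1" and h: "norm h \<le> \<eta>" and \<eta>: "0 \<le> \<eta>" "\<eta> \<le> 1" "\<eta>\<^sup>2 \<le> a4"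
    and yS: "norm y \<le> S + 2" and f: "norm f \<le> L" and US: "U q \<le> S" and q: "q \<noteq> 0"
    and v': "v' = c *\<^sub>R (y + h)"
  shows "a4 / 2 * norm q powr (- \<beta>1) - (C + a4 / 4 + 3 + L + (1 + a1 * (2 + a1 + a1 * a1)) * S)
    \<le> (- v' - gradU q - gradG q + f) \<bullet> sgn q + (y \<bullet> v' - (y \<bullet> sgn q) * (v' \<bullet> sgn q)) / norm q"
proof -
  have n1: "norm (sgn q) = 1" using q by (simp add: norm_sgn)
  have cs: "x \<bullet> sgn q \<le> norm x" "- norm x \<le> x \<bullet> sgn q" for x
    using Cauchy_Schwarz_ineq2[of x "sgn q"] n1 by auto
  have "norm v' \<le> norm (y + h)" using c mult_right_mono[of c 1 "norm (y + h)"] by (simp add: v')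
  also have "\<dots> \<le> S + 3" using norm_triangle_ineq[of y h] yS h \<eta> by simp
  finally have 1: "v' \<bullet> sgn q \<le> S + 3" using cs(1)[of v'] by simp
  have "norm (gradU q) \<le> a1 * (2 + a1 + a1 * a1) * S"
    by (rule order_trans[OF gradU_le_U mult_left_mono[OF US]]) (use a1_pos in simp)
  then have 2: "gradU q \<bullet> sgn q \<le> a1 * (2 + a1 + a1 * a1) * S" using cs(1)[of "gradU q"] by simp
  have 3: "- L \<le> f \<bullet> sgn q" using cs(2)[of f] f by simp
  have "\<eta>\<^sup>2 / 4 * (1 / norm q) \<le> a4 / 4 * (1 + norm q powr (- \<beta>1))"
    using \<eta> inverse_norm_le[OF q] a4_pos by (intro mult_mono) auto
  moreover have "- (\<eta>\<^sup>2 / 4) / norm q \<le> (y \<bullet> v' - (y \<bullet> sgn q) * (v' \<bullet> sgn q)) / norm q"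
    unfolding v' by (intro divide_right_mono angular_bound n1 c h) auto
  ultimately have 4: "- (a4 / 4 * (1 + norm q powr (- \<beta>1))) \<le> (y \<bullet> v' - (y \<bullet> sgn q) * (v' \<bullet> sgn q)) / norm q"
    by simp
  show ?thesis using 1 2 3 4 C unfolding inner_add_left inner_diff_left inner_minus_left
    by (simp add: algebra_simps)
qed

text \<open>All rates are bounded through the maximum S of kinetic energy plus U over [0,T].
  Integrating the rate of E - \<kappa> Z up to the time of the maximum gives an inequality for S
  whose right-hand side can be absorbed. Both \<eta> and C are fixed before the velocity law and the
  path, so the bound is uniform in \<epsilon>.\<close>

lemma apriori_core:
  assumes T: "T > 0"
  shows "\<exists>\<eta> C. 0 < \<eta> \<and> \<eta> \<le> 1 \<and> (\<forall>v K h f y q L. kinetic v K \<longrightarrow> 0 \<le> L \<longrightarrow> q 0 = q0 \<longrightarrow> norm (y 0) \<le> norm p0 + 1 \<longrightarrow>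
     (\<forall>t\<in>{0..T}. q t \<noteq> 0 \<and> norm (h t) \<le> \<eta> \<and> norm (f t) \<le> L
        \<and> (q has_vector_derivative v (y t + h t)) (at t within {0..T})
        \<and> (y has_vector_derivative (- v (y t + h t) - gradU (q t) - gradG (q t) + f t)) (at t within {0..T})) \<longrightarrow>
     (\<forall>t\<in>{0..T}. K (y t) + U (q t) \<le> C * (1 + L\<^sup>2)))"
proof -
  define C1 where "C1 = a1 * (2 + a1 + a1 * a1)"
  obtain C2 where C2: "\<And>q. q \<noteq> 0 \<Longrightarrow> U q / 2 - C2 \<le> U q + G q" using potential_lower by blast
  obtain C3 where C3: "C3 \<ge> 0" "\<And>q. q \<noteq> 0 \<Longrightarrow> 3 / 4 * a4 * norm q powr (- \<beta>1) - C3 \<le> - (gradG q \<bullet> sgn q)"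
    using repulsion by blast
  have C1: "C1 \<ge> 0" using a1_pos by (simp add: C1_def)
  \<comment> \<open>With \<open>\<kappa> = \<eta> * k0\<close> the gain
    \<open>\<kappa> * a4 / 2\<close> equals the loss \<open>\<eta> * a1\<close>, so the singular
    terms cancel exactly.\<close>
  define k0 where "k0 = 2 * a1 / a4"
  have k0: "k0 > 0" using a1_pos a4_pos by (simp add: k0_def)
  \<comment> \<open>The coefficient of \<open>\<eta> * S\<close> in the final estimate: 2 k0 from
    the values of Z at the two ends, the rest from the rate integrated over a time at most
    T.\<close>
  define M where "M = 2 * k0 + T * (C1 + k0 * (1 + C1))"
  have M: "M \<ge> 0" using k0 T C1 by (simp add: M_def)
  \<comment> \<open>so small that the terms proportional to S in the final estimate sum up to at most \<open>S/8\<close>\<close>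
  define \<eta> where "\<eta> = min (min 1 a4) (1 / (8 * M + 1))"
  have \<eta>: "0 < \<eta>" "\<eta> \<le> 1" "\<eta> \<le> a4" "\<eta> * M \<le> 1 / 8"
  proof -
    show "0 < \<eta>" "\<eta> \<le> 1" "\<eta> \<le> a4" using a4_pos M by (auto simp: \<eta>_def)
    have "\<eta> * M \<le> 1 / (8 * M + 1) * M" using M by (intro mult_right_mono) (auto simp: \<eta>_def)
    also have "\<dots> \<le> 1 / 8" using M by (simp add: field_simps)
    finally show "\<eta> * M \<le> 1 / 8" .
  qed
  have \<eta>2: "\<eta>\<^sup>2 \<le> a4" using \<eta> mult_left_mono[of \<eta> 1 \<eta>] unfolding power2_eq_square by linarith
  define E0 where "E0 = (norm p0 + 1)\<^sup>2 + U q0 + G q0"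
  define D where "D = \<bar>C2\<bar> + \<bar>E0\<bar> + 4 * k0 + T * (1 + a1 + k0 * (C3 + a4 / 4 + 3))"
  define C where "C = 4 * (D + 4 * T\<^sup>2 + k0 * T)"
  show ?thesis
  proof (intro exI conjI allI impI)
    show "0 < \<eta>" "\<eta> \<le> 1" by (rule \<eta>)+
    fix v K h f y q L
    assume kin: "kinetic v K" and L: "(0::real) \<le> L" and q0: "q (0::real) = q0" and y0: "norm (y (0::real)) \<le> norm p0 + 1"
      and *: "\<forall>t\<in>{0..T}. q t \<noteq> 0 \<and> norm (h t) \<le> \<eta> \<and> norm (f t) \<le> L
        \<and> (q has_vector_derivative v (y t + h t)) (at t within {0..T})
        \<and> (y has_vector_derivative (- v (y t + h t) - gradU (q t) - gradG (q t) + f t)) (at t within {0..T})"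
    have grK: "GDERIV K x :> v x" and vlip: "norm (v x - v z) \<le> norm (x - z)"
      and vc: "\<exists>c. 0 \<le> c \<and> c \<le> 1 \<and> v x = c *\<^sub>R x" and K0: "0 \<le> K x" and Kn: "norm x \<le> K x + 2"
      and vK: "(norm (v x))\<^sup>2 \<le> 2 * K x" and K2: "K x \<le> (norm x)\<^sup>2" for x z
      using kin unfolding kinetic_def by blast+
    have dq: "(q has_vector_derivative v (y t + h t)) (at t within {0..T})"
      and dy: "(y has_vector_derivative (- v (y t + h t) - gradU (q t) - gradG (q t) + f t)) (at t within {0..T})"
      and qn: "q t \<noteq> 0" and hn: "norm (h t) \<le> \<eta>" and fn: "norm (f t) \<le> L" if "t \<in> {0..T}" for t
      using * that by blast+
    have "continuous_on {0..T} (\<lambda>t. K (y t) + U (q t))"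
      unfolding continuous_on_eq_continuous_within
      by (intro ballI continuous_add DERIV_continuous[OF GDERIV_chain_curve[OF grK dy]]
          DERIV_continuous[OF GDERIV_chain_curve[OF U_grad dq]])
    from continuous_attains_sup[OF compact_Icc _ this] T
    obtain \<tau> where \<tau>: "\<tau> \<in> {0..T}" and max: "\<And>t. t \<in> {0..T} \<Longrightarrow> K (y t) + U (q t) \<le> K (y \<tau>) + U (q \<tau>)"
      by auto
    \<comment> \<open>G is left out of S: both remaining summands are nonnegative, so S bounds each
      of them at every time.\<close>
    define S where "S = K (y \<tau>) + U (q \<tau>)"
    have US: "U (q t) \<le> S" and KS: "K (y t) \<le> S" if "t \<in> {0..T}" for t
      using max[OF that] K0[of "y t"] U_ge1[of "q t"] by (auto simp: S_def)
    have S1: "S \<ge> 1" using K0[of "y \<tau>"] U_ge1[of "q \<tau>"] by (simp add: S_def)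
    define \<kappa> where "\<kappa> = \<eta> * k0"
    have \<kappa>: "0 \<le> \<kappa>" "\<kappa> \<le> k0" using \<eta> k0 by (auto simp: \<kappa>_def)
    let ?E = "\<lambda>s. K (y s) + U (q s) + G (q s)"
    define Z where "Z = (\<lambda>s. (y s \<bullet> q s) / norm (q s))"
    define A where "A = 1 + L * sqrt (2 * S) + \<eta> * C1 * S + \<eta> * a1 + \<kappa> * (C3 + a4 / 4 + 3 + L + (1 + C1) * S)"
    have "\<exists>d. ((\<lambda>s. ?E s - \<kappa> * Z s) has_real_derivative d) (at t within {0..T}) \<and> d \<le> A" if t: "t \<in> {0..T}" for t
    proof -
      let ?v' = "v (y t + h t)" and ?x = "norm (q t) powr (- \<beta>1)"
      define dE where "dE = - (v (y t) \<bullet> ?v') + v (y t) \<bullet> f t + (gradU (q t) + gradG (q t)) \<bullet> (?v' - v (y t))"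
      define dZ where "dZ = (- ?v' - gradU (q t) - gradG (q t) + f t) \<bullet> sgn (q t)
         + (y t \<bullet> ?v' - (y t \<bullet> sgn (q t)) * (?v' \<bullet> sgn (q t))) / norm (q t)"
      have dE: "(?E has_real_derivative dE) (at t within {0..T})"
        unfolding dE_def by (rule energy_derivative[OF grK U_grad G_grad[OF qn[OF t]] dq[OF t] dy[OF t]])
      have dZ: "(Z has_real_derivative dZ) (at t within {0..T})"
        unfolding dZ_def Z_def by (rule radial_derivative[OF qn[OF t] dq[OF t] dy[OF t]])
      obtain c where c: "0 \<le> c" "c \<le> 1" "?v' = c *\<^sub>R (y t + h t)" using vc by blast
      have vd: "norm (?v' - v (y t)) \<le> \<eta>" using vlip[of "y t + h t" "y t"] hn[OF t] by simp
      have vS: "(norm (v (y t)))\<^sup>2 \<le> 2 * S" using vK[of "y t"] KS[OF t] by simp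
      have yS: "norm (y t) \<le> S + 2" using Kn[of "y t"] KS[OF t] by simp
      have bE: "dE \<le> 1 + L * sqrt (2 * S) + \<eta> * C1 * S + \<eta> * a1 * (1 + ?x)"
        unfolding C1_def dE_def by (rule energy_rate[OF vd _ _ vS fn[OF t] US[OF t] qn[OF t]]) (use \<eta> in auto)
      have bZ: "a4 / 2 * ?x - (C3 + a4 / 4 + 3 + L + (1 + C1) * S) \<le> dZ"
        unfolding C1_def dZ_def by (rule radial_rate[OF C3(2)[OF qn[OF t]] c(1,2) hn[OF t] _ _ \<eta>2 yS fn[OF t] US[OF t] qn[OF t] c(3)])
          (use \<eta> in auto)
      have "\<kappa> * (a4 / 2 * ?x - (C3 + a4 / 4 + 3 + L + (1 + C1) * S)) \<le> \<kappa> * dZ"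
        using bZ \<kappa>(1) by (rule mult_left_mono)
      moreover have "\<kappa> * (a4 / 2 * ?x) = \<eta> * a1 * ?x" using a4_pos by (simp add: \<kappa>_def k0_def)
      ultimately have "dE - \<kappa> * dZ \<le> A" using bE
        unfolding A_def right_diff_distrib[of \<kappa>] distrib_left[of "\<eta> * a1"] by linarith
      moreover have "((\<lambda>s. ?E s - \<kappa> * Z s) has_real_derivative (dE - \<kappa> * dZ)) (at t within {0..T})"
        by (intro DERIV_diff dE DERIV_cmult dZ)
      ultimately show ?thesis by blast
    qed
    then have "\<exists>d. \<forall>t\<in>{0..T}. ((\<lambda>s. ?E s - \<kappa> * Z s) has_real_derivative d t) (at t within {0..T}) \<and> d t \<le> A"
      by (intro bchoice ballI)
    then obtain d where dd: "\<forall>t\<in>{0..T}. ((\<lambda>s. ?E s - \<kappa> * Z s) has_real_derivative d t) (at t within {0..T}) \<and> d t \<le> A"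
      by (elim exE)
    have d: "((\<lambda>s. ?E s - \<kappa> * Z s) has_real_derivative d t) (at t within {0..T})" and dA: "d t \<le> A"
      if "t \<in> {0..T}" for t
      using bspec[OF dd that] by (rule conjunct1, rule conjunct2)
    have A0: "A \<ge> 0" using L S1 \<eta> C1 C3 \<kappa> a1_pos a4_pos by (simp add: A_def)
    have "(?E \<tau> - \<kappa> * Z \<tau>) - (?E 0 - \<kappa> * Z 0) \<le> A * \<tau>"
    proof -
      have "((\<lambda>t. d t) has_integral ((?E \<tau> - \<kappa> * Z \<tau>) - (?E 0 - \<kappa> * Z 0))) {0..\<tau>}"
      proof (rule fundamental_theorem_of_calculus)
        fix x assume x: "x \<in> {0..\<tau>}"
        show "((\<lambda>s. ?E s - \<kappa> * Z s) has_vector_derivative d x) (at x within {0..\<tau>})"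
          unfolding has_real_derivative_iff_has_vector_derivative[symmetric]
          by (rule DERIV_subset[OF d]) (use x \<tau> in auto)
      qed (use \<tau> in simp)
      moreover have "((\<lambda>t. A) has_integral (A * \<tau>)) {0..\<tau>}"
        using has_integral_const_real[of A 0 \<tau>] \<tau> by (simp add: mult.commute)
      ultimately show ?thesis by (rule has_integral_le) (use dA \<tau> in auto)
    qed
    also have "\<dots> \<le> A * T" using A0 \<tau> by (intro mult_left_mono) auto
    finally have 1: "?E \<tau> \<le> ?E 0 + \<kappa> * (Z \<tau> - Z 0) + A * T"
      unfolding right_diff_distrib by linarith
    have Zb: "\<bar>Z t\<bar> \<le> S + 2" if "t \<in> {0..T}" for t
    proof -
      have "\<bar>y t \<bullet> q t\<bar> / norm (q t) \<le> norm (y t)"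
        using Cauchy_Schwarz_ineq2[of "y t" "q t"] qn[OF that] by (simp add: pos_divide_le_eq)
      then show ?thesis using Kn[of "y t"] KS[OF that] by (simp add: Z_def)
    qed
    have "Z \<tau> - Z 0 \<le> 2 * (S + 2)" 
    proof -
      have "0 \<in> {0..T}" using T by simp
      then have "- Z 0 \<le> S + 2" by (rule order_trans[OF abs_ge_minus_self Zb])
      moreover have "Z \<tau> \<le> S + 2" using Zb[OF \<tau>] by (rule order_trans[OF abs_ge_self])
      ultimately show ?thesis using add_mono[of "Z \<tau>" "S + 2" "- Z 0" "S + 2"] by simp
    qed
    then have 2: "\<kappa> * (Z \<tau> - Z 0) \<le> \<kappa> * (2 * (S + 2))" using \<kappa>(1) by (rule mult_left_mono)
    have 3: "?E 0 \<le> E0"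
    proof -
      have "K (y 0) \<le> (norm (y 0))\<^sup>2" by (rule K2)
      also have "\<dots> \<le> (norm p0 + 1)\<^sup>2" using y0 by (intro power_mono) auto
      finally show ?thesis by (simp add: E0_def q0)
    qed
    have 4: "S / 2 - C2 \<le> ?E \<tau>" using C2[OF qn[OF \<tau>]] K0[of "y \<tau>"] by (simp add: S_def field_simps)
    \<comment> \<open>Young's inequality, with weights chosen to leave S/8.\<close>
    have 5: "T * (L * sqrt (2 * S)) \<le> S / 8 + 4 * T\<^sup>2 * L\<^sup>2"
    proof -
      have "0 \<le> (sqrt (2 * S) / 4 - 2 * T * L)\<^sup>2" by simp
      also have "\<dots> = S / 8 + 4 * T\<^sup>2 * L\<^sup>2 - T * (L * sqrt (2 * S))"
        using S1 by (simp add: power2_diff power_divide power_mult_distrib field_simps)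
      finally show ?thesis by simp
    qed
    have "S / 2 \<le> C2 + E0 + \<kappa> * (2 * (S + 2)) + A * T" using 1 2 3 4 by linarith
    also have "\<dots> = C2 + E0 + 4 * \<kappa> + T * (1 + \<eta> * a1 + \<kappa> * (C3 + a4 / 4 + 3)) + (\<eta> * M) * S
        + T * (L * sqrt (2 * S)) + \<kappa> * T * L"
      by (simp add: A_def M_def \<kappa>_def algebra_simps)
    also have "\<dots> \<le> D + 1 / 8 * S + (S / 8 + 4 * T\<^sup>2 * L\<^sup>2) + k0 * T * L"
    proof -
      have "4 * \<kappa> \<le> 4 * k0" using \<kappa> by simp
      moreover have "T * (1 + \<eta> * a1 + \<kappa> * (C3 + a4 / 4 + 3)) \<le> T * (1 + 1 * a1 + k0 * (C3 + a4 / 4 + 3))"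
        using T \<eta> a1_pos \<kappa> C3 a4_pos by (intro mult_left_mono add_mono mult_right_mono) auto
      moreover have "(\<eta> * M) * S \<le> 1 / 8 * S" using \<eta> S1 by (intro mult_right_mono) auto
      moreover have "\<kappa> * T * L \<le> k0 * T * L" using \<kappa> T L by (intro mult_right_mono) auto
      ultimately show ?thesis using 5 unfolding D_def mult_1_left by linarith
    qed
    \<comment> \<open>Two eighths of S are absorbed into S/2; the remaining quarter gives the factor
      4.\<close>
    finally have "S \<le> 4 * (D + 4 * T\<^sup>2 * L\<^sup>2 + k0 * T * L)" by simp
    also have "\<dots> \<le> C * (1 + L\<^sup>2)"
    proof -
      have "L \<le> 1 + L\<^sup>2" using sum_power2_ge_zero[of "L - 1" 0] L by (simp add: power2_diff)
      then have "k0 * T * L \<le> k0 * T * (1 + L\<^sup>2)" using k0 T by (intro mult_left_mono) auto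
      moreover have "0 \<le> D * L\<^sup>2" using k0 T a1_pos C3 a4_pos by (simp add: D_def)
      ultimately have le: "D + 4 * T\<^sup>2 * L\<^sup>2 + k0 * T * L \<le> D + D * L\<^sup>2 + 4 * T\<^sup>2 + 4 * T\<^sup>2 * L\<^sup>2 + k0 * T * (1 + L\<^sup>2)"
        using zero_le_power2[of T] by linarith
      have eq: "C * (1 + L\<^sup>2) = 4 * (D + D * L\<^sup>2 + 4 * T\<^sup>2 + 4 * T\<^sup>2 * L\<^sup>2 + k0 * T * (1 + L\<^sup>2))"
        by (simp add: C_def algebra_simps)
      show ?thesis unfolding eq by (rule mult_left_mono[OF le]) simp
    qed
    finally have "S \<le> C * (1 + L\<^sup>2)" .
    then show "\<forall>t\<in>{0..T}. K (y t) + U (q t) \<le> C * (1 + L\<^sup>2)" using max unfolding S_def by force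
  qed
qed

end

section \<open>Smoothing the noise\<close>

text \<open>A difference of two values of the antiderivative is differentiable although w is not.
  The window looks forward, which avoids negative times and needs the oscillation of w up to T +
  \<delta>.\<close>

lemma moving_average:
  fixes w :: "real \<Rightarrow> 'v::euclidean_space"
  assumes w: "continuous_on {0..} w" and \<delta>: "0 < \<delta>" and T: "0 \<le> T"
    and osc: "\<And>s t. 0 \<le> t \<Longrightarrow> t \<le> T \<Longrightarrow> t \<le> s \<Longrightarrow> s \<le> t + \<delta> \<Longrightarrow> norm (w t - w s) \<le> \<theta>"
  defines "m \<equiv> \<lambda>t. (1 / \<delta>) *\<^sub>R (integral {0..t + \<delta>} w - integral {0..t} w)"
  assumes t: "t \<in> {0..T}"
  shows "(m has_vector_derivative ((1 / \<delta>) *\<^sub>R (w (t + \<delta>) - w t))) (at t within {0..T})"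
    and "norm (w t - m t) \<le> \<theta>"
proof -
  have cw: "continuous_on {a..b} w" if "a \<ge> 0" for a b
    by (rule continuous_on_subset[OF w]) (use that in auto)
  have I: "((\<lambda>u. integral {0..u} w) has_vector_derivative w u) (at u within {0..T + \<delta>})" if "u \<in> {0..T + \<delta>}" for u
    by (rule integral_has_vector_derivative[OF cw that]) simp
  have "((\<lambda>u. integral {0..u} w) \<circ> (\<lambda>u. u + \<delta>) has_vector_derivative 1 *\<^sub>R w (t + \<delta>)) (at t within {0..T})"
  proof (rule vector_diff_chain_within)
    show "((\<lambda>u. u + \<delta>) has_vector_derivative 1) (at t within {0..T})"
      by (auto intro!: derivative_eq_intros)
    show "((\<lambda>u. integral {0..u} w) has_vector_derivative w (t + \<delta>)) (at (t + \<delta>) within (\<lambda>u. u + \<delta>) ` {0..T})"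
      by (rule has_vector_derivative_within_subset[OF I]) (use t \<delta> in auto)
  qed
  moreover have "((\<lambda>u. integral {0..u} w) has_vector_derivative w t) (at t within {0..T})"
    by (rule has_vector_derivative_within_subset[OF I]) (use t \<delta> in auto)
  ultimately show "(m has_vector_derivative ((1 / \<delta>) *\<^sub>R (w (t + \<delta>) - w t))) (at t within {0..T})"
    unfolding m_def o_def by (auto intro!: derivative_eq_intros)
  have i: "w integrable_on {a..b}" if "a \<ge> 0" for a b using cw[OF that] by (rule integrable_continuous_real)
  have comb: "integral {0..t} w + integral {t..t + \<delta>} w = integral {0..t + \<delta>} w"
    using t \<delta> by (intro Henstock_Kurzweil_Integration.integral_combine i) auto
  then have mt: "m t = (1 / \<delta>) *\<^sub>R integral {t..t + \<delta>} w" unfolding m_def by (simp flip: comb)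
  have "integral {t..t + \<delta>} (\<lambda>s. w t - w s) = \<delta> *\<^sub>R w t - integral {t..t + \<delta>} w"
    using t \<delta> i[of t "t + \<delta>"] by (subst integral_diff) auto
  then have "w t - m t = (1 / \<delta>) *\<^sub>R integral {t..t + \<delta>} (\<lambda>s. w t - w s)"
    using \<delta> by (simp add: mt scaleR_diff_right)
  moreover have "norm (integral {t..t + \<delta>} (\<lambda>s. w t - w s)) \<le> \<theta> * ((t + \<delta>) - t)"
    using t \<delta> osc by (intro integral_bound continuous_intros cw) auto
  ultimately show "norm (w t - m t) \<le> \<theta>" using \<delta> by (simp add: pos_divide_le_eq mult.commute)
qed

context singular_potential
begin

text \<open>The smoothed noise becomes a drift \<open>f\<close> of size at most \<eta>/\<delta>,
  because the increment of w over one window is at most \<theta>. The square of this size in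
  \<open>apriori_core\<close> produces the power of \<delta> in the bound.\<close>

lemma apriori_bound:
  assumes T: "T > 0" and cU: "continuous_on UNIV gradU" and cG: "continuous_on (-{0}) gradG"
  shows "\<exists>\<theta> C. 0 < \<theta> \<and> 0 \<le> C \<and> (\<forall>v K w \<delta> q p. kinetic v K \<longrightarrow> continuous_on {0..} w \<longrightarrow> w 0 = 0 \<longrightarrow>
     0 < \<delta> \<longrightarrow>
     (\<forall>s t. 0 \<le> t \<longrightarrow> t \<le> T \<longrightarrow> t \<le> s \<longrightarrow> s \<le> t + \<delta> \<longrightarrow> norm (w t - w s) \<le> \<theta>) \<longrightarrow>
     path_sol v (\<lambda>x. gradU x + gradG x) (-{0}) w q0 p0 q p \<longrightarrow>
     (\<forall>t\<in>{0..T}. norm (q t) \<le> C * (1 + 1 / \<delta>\<^sup>2) \<and> norm (p t) \<le> C * (1 + 1 / \<delta>\<^sup>2)))"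
proof -
  obtain \<eta> C where \<eta>: "0 < \<eta>" "\<eta> \<le> 1" and C: "\<forall>v K h f y q L. kinetic v K \<longrightarrow> 0 \<le> L \<longrightarrow> q 0 = q0 \<longrightarrow> norm (y 0) \<le> norm p0 + 1 \<longrightarrow>
     (\<forall>t\<in>{0..T}. q t \<noteq> 0 \<and> norm (h t) \<le> \<eta> \<and> norm (f t) \<le> L
        \<and> (q has_vector_derivative v (y t + h t)) (at t within {0..T})
        \<and> (y has_vector_derivative (- v (y t + h t) - gradU (q t) - gradG (q t) + f t)) (at t within {0..T})) \<longrightarrow>
     (\<forall>t\<in>{0..T}. K (y t) + U (q t) \<le> C * (1 + L\<^sup>2))"
    using apriori_core[OF T, of q0 p0] by (elim exE conjE) (rule that)
  \<comment> \<open>The division compensates the factor sqrt 2 of the noise, so that |h| \<le>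
    \<eta>.\<close>
  define \<theta> where "\<theta> = \<eta> / sqrt 2"
  define B where "B = \<bar>C\<bar> + 4 + a1 * (\<bar>C\<bar> + a1)"
  have B: "B \<ge> 0" "\<bar>C\<bar> + 3 \<le> B" "1 + a1 * (\<bar>C\<bar> + a1) \<le> B" using a1_pos by (auto simp: B_def)
  show ?thesis
  proof (intro exI conjI allI impI)
    show "\<theta> > 0" "0 \<le> B" using \<eta> B by (auto simp: \<theta>_def)
    fix v K w \<delta> q p
    assume kin: "kinetic v K" and cw: "continuous_on {0..} w" and w0: "w (0::real) = 0" and \<delta>: "(0::real) < \<delta>"
      and osc: "\<forall>s t. 0 \<le> t \<longrightarrow> t \<le> T \<longrightarrow> t \<le> s \<longrightarrow> s \<le> t + \<delta> \<longrightarrow> norm (w t - w s) \<le> \<theta>"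
      and sol: "path_sol v (\<lambda>x. gradU x + gradG x) (-{0}) w q0 p0 q p"
    define m where "m = (\<lambda>t. (1 / \<delta>) *\<^sub>R (integral {0..t + \<delta>} w - integral {0..t} w))"
    have m: "(m has_vector_derivative ((1 / \<delta>) *\<^sub>R (w (t + \<delta>) - w t))) (at t within {0..T})"
      "norm (w t - m t) \<le> \<theta>" if "t \<in> {0..T}" for t
      using moving_average[OF cw \<delta> _ _ that, of \<theta>] T osc unfolding m_def by auto
    define h where "h = (\<lambda>t. sqrt 2 *\<^sub>R (w t - m t))"
    define y where "y = (\<lambda>t. p t - h t)"
    define f where "f = (\<lambda>t. sqrt 2 *\<^sub>R ((1 / \<delta>) *\<^sub>R (w (t + \<delta>) - w t)))"
    have hn: "norm (h t) \<le> \<eta>" if "t \<in> {0..T}" for t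
      using mult_left_mono[OF m(2)[OF that], of "sqrt 2"] by (simp add: h_def \<theta>_def)
    have fn: "norm (f t) \<le> \<eta> / \<delta>" if "t \<in> {0..T}" for t
    proof -
      have "norm (w t - w (t + \<delta>)) \<le> \<theta>" using osc that \<delta> by auto
      then have "sqrt 2 * norm (w (t + \<delta>) - w t) \<le> sqrt 2 * \<theta>" by (simp add: norm_minus_commute)
      then have "sqrt 2 * norm (w (t + \<delta>) - w t) \<le> \<eta>" by (simp add: \<theta>_def)
      from divide_right_mono[OF this, of \<delta>] show ?thesis using \<delta> by (simp add: f_def)
    qed
    have cq: "continuous_on {0..T} q" and cp: "continuous_on {0..T} p"
      using path_solD(1,2)[OF sol] by (auto elim: continuous_on_subset)
    have nonneg: "0 \<le> t" if "t \<in> {0..T}" for t using that by simp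
    have qn: "q t \<noteq> 0" if "t \<in> {0..T}" for t
      using path_solD(3)[OF sol nonneg[OF that]] by simp
    note qt = path_solD(4)[OF sol nonneg] and pt = path_solD(5)[OF sol nonneg]
    have cv: "continuous_on UNIV v"
      by (rule lipschitz_on_continuous_on[of 1]) (use kin in \<open>auto intro!: lipschitz_onI simp: dist_norm kinetic_def\<close>)
    have cvp: "continuous_on {0..T} (\<lambda>t. v (p t))" by (rule continuous_on_compose2[OF cv cp]) auto
    have cF: "continuous_on {0..T} (\<lambda>t. gradU (q t) + gradG (q t))"
      using qn by (intro continuous_on_add continuous_on_compose2[OF cU cq] continuous_on_compose2[OF cG cq]) auto
    have dq: "(q has_vector_derivative v (p t)) (at t within {0..T})" if t: "t \<in> {0..T}" for t
    proof (rule has_vector_derivative_transform[OF t])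
      show "((\<lambda>u. q0 + integral {0..u} (\<lambda>s. v (p s))) has_vector_derivative v (p t)) (at t within {0..T})"
        by (auto intro!: derivative_eq_intros integral_has_vector_derivative[OF cvp t])
      show "q u = q0 + integral {0..u} (\<lambda>s. v (p s))" if "u \<in> {0..T}" for u using that by (rule qt)
    qed
    have dy: "(y has_vector_derivative (- v (p t) - gradU (q t) - gradG (q t) + f t)) (at t within {0..T})" if t: "t \<in> {0..T}" for t
    proof (rule has_vector_derivative_transform[OF t])
      have "continuous_on {0..T} (\<lambda>s. - v (p s) - (gradU (q s) + gradG (q s)))"
        by (intro continuous_intros cvp cF)
      note i = integral_has_vector_derivative[OF this t]
      have mm: "((\<lambda>u. sqrt 2 *\<^sub>R m u) has_vector_derivative f t) (at t within {0..T})"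
        unfolding f_def using m(1)[OF t] by (auto intro!: derivative_eq_intros)
      have "((\<lambda>u. p0 + integral {0..u} (\<lambda>s. - v (p s) - (gradU (q s) + gradG (q s))) + sqrt 2 *\<^sub>R m u)
          has_vector_derivative (0 + (- v (p t) - (gradU (q t) + gradG (q t))) + f t)) (at t within {0..T})"
        by (intro has_vector_derivative_add has_vector_derivative_const i mm)
      then show "((\<lambda>u. p0 + integral {0..u} (\<lambda>s. - v (p s) - (gradU (q s) + gradG (q s))) + sqrt 2 *\<^sub>R m u)
          has_vector_derivative (- v (p t) - gradU (q t) - gradG (q t) + f t)) (at t within {0..T})"
        by (simp add: algebra_simps)
      \<comment> \<open>Subtracting h replaces w by its average m, so only differentiable terms are
        left.\<close>
      show "y u = p0 + integral {0..u} (\<lambda>s. - v (p s) - (gradU (q s) + gradG (q s))) + sqrt 2 *\<^sub>R m u"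
        if "u \<in> {0..T}" for u
        unfolding y_def h_def by (subst pt[OF that]) (simp add: algebra_simps)
    qed
    have y0: "norm (y 0) \<le> norm p0 + 1"
      using norm_triangle_ineq4[of "p 0" "h 0"] hn[of 0] T \<eta> path_sol_initial[OF sol w0] by (simp add: y_def)
    have yh: "y t + h t = p t" for t by (simp add: y_def)
    have KU: "K (y t) + U (q t) \<le> C * (1 + (\<eta> / \<delta>)\<^sup>2)" if "t \<in> {0..T}" for t
    proof -
      have "\<forall>t\<in>{0..T}. K (y t) + U (q t) \<le> C * (1 + (\<eta> / \<delta>)\<^sup>2)"
      proof (rule C[THEN spec[of _ v], THEN spec[of _ K], THEN spec[of _ h], THEN spec[of _ f], THEN spec[of _ y],
            THEN spec[of _ q], THEN spec[of _ "\<eta> / \<delta>"], THEN mp, THEN mp, THEN mp, THEN mp, THEN mp])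
        show "kinetic v K" "norm (y 0) \<le> norm p0 + 1" by fact+
        show "0 \<le> \<eta> / \<delta>" "q 0 = q0" using \<eta> \<delta> path_sol_initial[OF sol w0] by auto
        show "\<forall>t\<in>{0..T}. q t \<noteq> 0 \<and> norm (h t) \<le> \<eta> \<and> norm (f t) \<le> \<eta> / \<delta>
          \<and> (q has_vector_derivative v (y t + h t)) (at t within {0..T})
          \<and> (y has_vector_derivative (- v (y t + h t) - gradU (q t) - gradG (q t) + f t)) (at t within {0..T})"
          unfolding yh using qn hn fn dq dy by blast
      qed
      then show ?thesis using that by blast
    qed
    show "\<forall>t\<in>{0..T}. norm (q t) \<le> B * (1 + 1 / \<delta>\<^sup>2) \<and> norm (p t) \<le> B * (1 + 1 / \<delta>\<^sup>2)"
    proof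
      fix t assume t: "t \<in> {0..T}"
      define X where "X = 1 + 1 / \<delta>\<^sup>2"
      have X: "X \<ge> 1" by (simp add: X_def)
      have "\<eta>\<^sup>2 \<le> 1" using \<eta> by (simp add: power_le_one)
      then have "(\<eta> / \<delta>)\<^sup>2 \<le> 1 / \<delta>\<^sup>2" by (simp add: power_divide divide_right_mono)
      then have "C * (1 + (\<eta> / \<delta>)\<^sup>2) \<le> \<bar>C\<bar> * X" unfolding X_def by (intro mult_mono) auto
      then have le: "K (y t) + U (q t) \<le> \<bar>C\<bar> * X" using KU[OF t] by simp
      have K: "0 \<le> K (y t)" "norm (y t) \<le> K (y t) + 2" using kin by (auto simp: kinetic_def)
      have "norm (p t) \<le> norm (y t) + norm (h t)" using norm_triangle_ineq[of "y t" "h t"] by (simp add: yh)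
      also have "\<dots> \<le> \<bar>C\<bar> * X + 3" using K hn[OF t] \<eta> le U_ge1[of "q t"] by linarith
      also have "\<dots> \<le> (\<bar>C\<bar> + 3) * X" using X by (simp add: algebra_simps)
      also have "\<dots> \<le> B * X" using X B by (intro mult_right_mono) auto
      finally have 1: "norm (p t) \<le> B * X" .
      have "norm (q t) \<le> 1 + a1 * (U (q t) + a1)" by (rule norm_le_U)
      also have "\<dots> \<le> 1 * X + a1 * (\<bar>C\<bar> * X + a1 * X)" 
        using le K X a1_pos by (intro add_mono mult_left_mono) auto
      also have "\<dots> = (1 + a1 * (\<bar>C\<bar> + a1)) * X" by (simp add: algebra_simps)
      also have "\<dots> \<le> B * X" using X B by (intro mult_right_mono) auto
      finally show "norm (q t) \<le> B * (1 + 1 / \<delta>\<^sup>2) \<and> norm (p t) \<le> B * (1 + 1 / \<delta>\<^sup>2)"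
        using 1 by (simp add: X_def)
    qed
  qed
qed

end

section \<open>Moments of the modulus of continuity of Brownian motion\<close>

lemma std_BM_D:
  assumes "std_BM M W"
  shows "prob_space M" "W t \<in> borel_measurable M"
    and "\<omega> \<in> space M \<Longrightarrow> W 0 \<omega> = 0" "\<omega> \<in> space M \<Longrightarrow> continuous_on {0..} (\<lambda>t. W t \<omega>)"
    and "0 \<le> s \<Longrightarrow> s < t \<Longrightarrow>
          distributed M lborel (\<lambda>\<omega>. W t \<omega> - W s \<omega>) (\<lambda>x. ennreal (gauss_density (t - s) x))"
  using assms unfolding std_BM_def by blast+

lemma power_le_fact_exp:
  fixes u :: real assumes "0 \<le> u"
  shows "u ^ j \<le> fact j * exp u"
proof -
  have "u ^ j / fact j \<le> exp u"
    using sum_le_suminf[OF summable_exp_generic[of u], of "{j}"] assms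
    by (simp add: exp_def divide_inverse mult.commute)
  then show ?thesis by (simp add: field_simps)
qed

text \<open>The factorial and the power of 4 come from (u/4)^j \<le> j! exp(u/4), the power of 2
  from the ratio of the normalizing constants for variances r and 2r.\<close>

definition gauss_moment_const :: "'b::euclidean_space itself \<Rightarrow> nat \<Rightarrow> real" where
  "gauss_moment_const _ j = fact j * 4 ^ j * 2 powr (real DIM('b) / 2)"

text \<open>Comparison with the density of twice the variance reduces Gaussian moments to total mass one.\<close>
lemma gauss_density_moment_le:
  fixes x :: "'b::euclidean_space"
  assumes r: "r > 0"
  shows "norm x ^ (2 * j) * gauss_density r x \<le> gauss_moment_const TYPE('b) j * r ^ j * gauss_density (2 * r) x"
proof -
  define u where "u = (norm x)\<^sup>2 / r"
  have u: "u \<ge> 0" using r by (simp add: u_def)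
  have "norm x ^ (2 * j) = r ^ j * u ^ j" using r by (simp add: u_def power_mult power_divide)
  also have "u ^ j = 4 ^ j * (u / 4) ^ j" by (simp add: power_divide)
  also have "(u / 4) ^ j \<le> fact j * exp (u / 4)" by (rule power_le_fact_exp) (use u in simp)
  finally have "norm x ^ (2 * j) \<le> r ^ j * (4 ^ j * (fact j * exp (u / 4)))" using r by simp
  then have "norm x ^ (2 * j) * gauss_density r x
      \<le> r ^ j * (4 ^ j * (fact j * exp (u / 4))) * gauss_density r x"
    by (intro mult_right_mono) (auto simp: gauss_density_def)
  also have "\<dots> = gauss_moment_const TYPE('b) j * r ^ j * gauss_density (2 * r) x"
  proof -
    have 1: "(2 * pi * (2 * r)) powr (- real DIM('b) / 2) = 2 powr (- real DIM('b) / 2) * (2 * pi * r) powr (- real DIM('b) / 2)"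
      using r powr_mult[of 2 "2 * pi * r" "- real DIM('b) / 2"] by (simp add: mult_ac)
    have 2: "2 powr (real DIM('b) / 2) * 2 powr (- real DIM('b) / 2) = (1::real)"
      by (simp flip: powr_add)
    have 3: "exp (u / 4) * exp (- (norm x)\<^sup>2 / (2 * r)) = exp (- (norm x)\<^sup>2 / (2 * (2 * r)))"
      using r by (simp add: u_def field_simps flip: exp_add)
    have "gauss_moment_const TYPE('b) j * r ^ j * gauss_density (2 * r) x
      = fact j * 4 ^ j * (2 powr (real DIM('b) / 2) * 2 powr (- real DIM('b) / 2)) * r ^ j
         * (2 * pi * r) powr (- real DIM('b) / 2) * exp (- (norm x)\<^sup>2 / (2 * (2 * r)))"
      unfolding gauss_moment_const_def gauss_density_def 1 by (simp only: mult_ac)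
    also have "\<dots> = fact j * 4 ^ j * r ^ j * (2 * pi * r) powr (- real DIM('b) / 2) * (exp (u / 4) * exp (- (norm x)\<^sup>2 / (2 * r)))"
      unfolding 2 3 by simp
    finally show ?thesis by (simp only: gauss_density_def mult_ac)
  qed
  finally show ?thesis .
qed

lemma BM_increment_moment:
  fixes W :: "real \<Rightarrow> 'a \<Rightarrow> 'b::euclidean_space"
  assumes bm: "std_BM M W" and st: "0 \<le> s" "s < t"
  shows "(\<integral>\<^sup>+\<omega>. ennreal (norm (W t \<omega> - W s \<omega>) ^ (2 * j)) \<partial>M) \<le> ennreal (gauss_moment_const TYPE('b) j * (t - s) ^ j)"
proof -
  interpret prob_space M by (rule std_BM_D[OF bm])
  define r where "r = t - s"
  have r: "r > 0" using st by (simp add: r_def)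
  have C: "0 \<le> gauss_moment_const TYPE('b) j * r ^ j" using r by (simp add: gauss_moment_const_def)
  have g0: "0 \<le> gauss_density a x" for a and x :: 'b by (simp add: gauss_density_def)
  have gm [measurable]: "(gauss_density a :: 'b \<Rightarrow> real) \<in> borel_measurable borel" for a :: real
    unfolding gauss_density_def[abs_def] by measurable
  have d: "distributed M lborel (\<lambda>\<omega>. W t \<omega> - W s \<omega>) (\<lambda>x. ennreal (gauss_density r x))"
    unfolding r_def by (rule std_BM_D(5)[OF bm st])
  \<comment> \<open>The comparison density is itself the law of an increment, over a time 2r, so its
    total mass is 1 and no Gaussian integral has to be computed.\<close>
  have d2: "distributed M lborel (\<lambda>\<omega>. W (2 * r) \<omega> - W 0 \<omega>) (\<lambda>x. ennreal (gauss_density (2 * r) x))"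
    using std_BM_D(5)[OF bm, of 0 "2 * r"] r by simp
  have one: "(\<integral>\<^sup>+x. ennreal (gauss_density (2 * r) (x::'b)) \<partial>lborel) = 1"
    using distributed_nn_integral[OF d2, of "\<lambda>_. 1"] by (simp add: emeasure_space_1)
  have "(\<integral>\<^sup>+\<omega>. ennreal (norm (W t \<omega> - W s \<omega>) ^ (2 * j)) \<partial>M)
      = (\<integral>\<^sup>+x. ennreal (gauss_density r (x::'b)) * ennreal (norm x ^ (2 * j)) \<partial>lborel)"
    using distributed_nn_integral[OF d, of "\<lambda>x. ennreal (norm x ^ (2 * j))"] by simp
  also have "\<dots> \<le> (\<integral>\<^sup>+x. ennreal (gauss_moment_const TYPE('b) j * r ^ j) * ennreal (gauss_density (2 * r) (x::'b)) \<partial>lborel)"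
    using gauss_density_moment_le[OF r, where ?'b = 'b] C
    by (intro nn_integral_mono) (auto simp flip: ennreal_mult simp: g0 mult.commute[of "gauss_density r _"] intro!: ennreal_leI)
  also have "\<dots> = ennreal (gauss_moment_const TYPE('b) j * r ^ j)"
    by (subst nn_integral_cmult) (auto simp: one)
  finally show ?thesis by (simp add: r_def)
qed

text \<open>The weight \<open>5/4\<close> is less than \<open>\<surd>2\<close>, which makes the expectation finite, and satisfies
  \<open>(5/4)\<^sup>4 \<ge> 2\<close>, so that a scale \<open>2\<^bsup>-m\<^esup>\<close> is at least the fourth power of \<open>(4/5)\<^bsup>m\<^esup>\<close>.\<close>
definition hoelder_sum :: "nat \<Rightarrow> nat \<Rightarrow> (real \<Rightarrow> 'b::real_normed_vector) \<Rightarrow> ennreal" where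
  "hoelder_sum k J w = (\<Sum>m. \<Sum>j<J * 2 ^ m.
     ennreal (((5 / 4) ^ m * norm (w ((real j + 1) / 2 ^ m) - w (real j / 2 ^ m))) ^ k))"

lemma hoelder_sum_measurable:
  fixes W :: "real \<Rightarrow> 'a \<Rightarrow> 'b::euclidean_space"
  assumes [measurable]: "\<And>t. W t \<in> borel_measurable M"
  shows "(\<lambda>\<omega>. hoelder_sum k J (\<lambda>t. W t \<omega>)) \<in> borel_measurable M"
  unfolding hoelder_sum_def by measurable

lemma hoelder_sum_integrable:
  fixes W :: "real \<Rightarrow> 'a \<Rightarrow> 'b::euclidean_space"
  assumes bm: "std_BM M W" and n: "n \<ge> 1"
  shows "(\<integral>\<^sup>+\<omega>. hoelder_sum (8 * n) J (\<lambda>t. W t \<omega>) \<partial>M) < \<infinity>"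
proof -
  note [measurable] = std_BM_D(2)[OF bm]
  define K where "K = gauss_moment_const TYPE('b) (4 * n)"
  have K: "K \<ge> 0" by (simp add: K_def gauss_moment_const_def)
  \<comment> \<open>Ratio of the geometric series: level m has J 2^m increments, each with moment of
    order 2^(-4nm) and weight (5/4)^(8nm). It is below 1 for every n \<ge> 1 because (5/4)^8 <
    8.\<close>
  define x :: real where "x = 2 * ((5 / 4) ^ 8 / 16) ^ n"
  have "((5 / 4) ^ 8 / 16 :: real) ^ n \<le> ((5 / 4) ^ 8 / 16) ^ 1"
    by (rule power_decreasing) (use n in \<open>auto simp: power_divide\<close>)
  also have "\<dots> < 1 / 2" by (simp add: power_divide)
  finally have x: "0 \<le> x" "x < 1" unfolding x_def by auto
  let ?D = "\<lambda>m j \<omega>. norm (W ((real j + 1) / 2 ^ m) \<omega> - W (real j / 2 ^ m) \<omega>)"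
  have moment: "(\<integral>\<^sup>+\<omega>. ennreal (((5 / 4) ^ m * ?D m j \<omega>) ^ (8 * n)) \<partial>M) \<le> ennreal (K * (x / 2) ^ m)" for m j
  proof -
    have "(\<integral>\<^sup>+\<omega>. ennreal (((5 / 4) ^ m * ?D m j \<omega>) ^ (8 * n)) \<partial>M)
        = (\<integral>\<^sup>+\<omega>. ennreal (((5 / 4) ^ m) ^ (8 * n)) * ennreal (?D m j \<omega> ^ (2 * (4 * n))) \<partial>M)"
      by (intro nn_integral_cong) (simp add: power_mult_distrib ennreal_mult)
    also have "\<dots> = ennreal (((5 / 4) ^ m) ^ (8 * n)) * (\<integral>\<^sup>+\<omega>. ennreal (?D m j \<omega> ^ (2 * (4 * n))) \<partial>M)"
      by (rule nn_integral_cmult) measurable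
    also have "\<dots> \<le> ennreal (((5 / 4) ^ m) ^ (8 * n)) * ennreal (K * ((real j + 1) / 2 ^ m - real j / 2 ^ m) ^ (4 * n))"
      unfolding K_def by (intro mult_left_mono BM_increment_moment[OF bm]) (auto simp: divide_strict_right_mono)
    also have "\<dots> = ennreal (((5 / 4) ^ m) ^ (8 * n) * (K * ((real j + 1) / 2 ^ m - real j / 2 ^ m) ^ (4 * n)))"
      using K by (subst ennreal_mult) (auto simp: divide_right_mono)
    also have "((5 / 4) ^ m) ^ (8 * n) * (K * ((real j + 1) / 2 ^ m - real j / 2 ^ m) ^ (4 * n)) = K * (x / 2) ^ m"
    proof -
      have "(real j + 1) / 2 ^ m - real j / 2 ^ m = (1 / 2) ^ m" by (simp add: power_one_over divide_simps flip: diff_divide_distrib)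
      then have "((5 / 4) ^ m) ^ (8 * n) * (K * ((real j + 1) / 2 ^ m - real j / 2 ^ m) ^ (4 * n))
         = K * (((5 / 4) ^ 8 * (1 / 2) ^ 4) ^ n) ^ m"
        by (simp only: power_mult_distrib power_mult[symmetric] mult_ac)
      also have "((5 / 4) ^ 8 * (1 / 2) ^ 4 :: real) = (5 / 4) ^ 8 / 16" by (simp add: power_divide)
      finally show ?thesis by (simp add: x_def)
    qed
    finally show ?thesis .
  qed
  have "(\<integral>\<^sup>+\<omega>. hoelder_sum (8 * n) J (\<lambda>t. W t \<omega>) \<partial>M)
      = (\<Sum>m. \<integral>\<^sup>+\<omega>. (\<Sum>j<J * 2 ^ m. ennreal (((5 / 4) ^ m * ?D m j \<omega>) ^ (8 * n))) \<partial>M)"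
    unfolding hoelder_sum_def by (rule nn_integral_suminf) measurable
  also have "\<dots> \<le> (\<Sum>m. ennreal (real J * K * x ^ m))"
  proof (rule suminf_le)
    fix m
    have "(\<integral>\<^sup>+\<omega>. (\<Sum>j<J * 2 ^ m. ennreal (((5 / 4) ^ m * ?D m j \<omega>) ^ (8 * n))) \<partial>M)
        = (\<Sum>j<J * 2 ^ m. \<integral>\<^sup>+\<omega>. ennreal (((5 / 4) ^ m * ?D m j \<omega>) ^ (8 * n)) \<partial>M)"
      by (rule nn_integral_sum) measurable
    also have "\<dots> \<le> (\<Sum>j<J * 2 ^ m. ennreal (K * (x / 2) ^ m))" by (intro sum_mono moment)
    also have "\<dots> = ennreal (\<Sum>j<J * 2 ^ m. K * (x / 2) ^ m)" using K x by (intro sum_ennreal) auto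
    also have "(\<Sum>j<J * 2 ^ m. K * (x / 2) ^ m) = real J * K * x ^ m" by (simp add: power_divide)
    finally show "(\<integral>\<^sup>+\<omega>. (\<Sum>j<J * 2 ^ m. ennreal (((5 / 4) ^ m * ?D m j \<omega>) ^ (8 * n))) \<partial>M)
      \<le> ennreal (real J * K * x ^ m)" .
  qed auto
  also have "\<dots> < \<infinity>"
  proof -
    have "summable (\<lambda>m. real J * K * x ^ m)" using x by (intro summable_mult summable_geometric) auto
    then show ?thesis using K x by (subst suminf_ennreal2) auto
  qed
  finally show ?thesis .
qed

section \<open>From dyadic increments to a modulus of continuity\<close>

text \<open>The dyadic approximations of t from below either stay put or advance by one cell of the
  finer level. The jumps beyond level m sum to B times the tail of a geometric series, which is 4
  (4/5)^m, and continuity identifies the limit.\<close>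

lemma dyadic_chaining:
  fixes w :: "real \<Rightarrow> 'b::real_normed_vector"
  assumes w: "continuous_on {0..} w" and B: "0 \<le> B"
    and inc: "\<And>m j. j < J * 2 ^ m \<Longrightarrow> norm (w ((real j + 1) / 2 ^ m) - w (real j / 2 ^ m)) \<le> B * (4 / 5) ^ m"
    and t: "0 \<le> t" "t < real J"
  shows "norm (w t - w (real (nat \<lfloor>t * 2 ^ m\<rfloor>) / 2 ^ m)) \<le> 4 * B * (4 / 5) ^ m"
proof -
  define k where "k = (\<lambda>i. nat \<lfloor>t * 2 ^ i\<rfloor>)"
  define d where "d = (\<lambda>i. real (k i) / 2 ^ i)"
  have k: "real (k i) \<le> t * 2 ^ i" "t * 2 ^ i < real (k i) + 1" for i
    using t by (auto simp: k_def)
  have step: "norm (w (d (Suc i)) - w (d i)) \<le> B * (4 / 5) ^ Suc i" for i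
  proof -
    have "real (k (Suc i)) < real (2 * k i + 2)" "real (2 * k i) < real (k (Suc i) + 1)"
      using k[of i] k[of "Suc i"] by auto
    then have "k (Suc i) = 2 * k i \<or> k (Suc i) = 2 * k i + 1" unfolding of_nat_less_iff by auto
    then show ?thesis
    proof
      assume "k (Suc i) = 2 * k i"
      then have "d (Suc i) = d i" by (simp add: d_def)
      then show ?thesis using B by simp
    next
      assume k1: "k (Suc i) = 2 * k i + 1"
      have "t * 2 ^ i < real J * 2 ^ i" using t by simp
      then have "real (k i) < real J * 2 ^ i" using k(1)[of i] by linarith
      then have "real (k i) < real (J * 2 ^ i)" by simp
      then have "2 * k i < J * 2 ^ Suc i" unfolding of_nat_less_iff by simp
      from inc[OF this] show ?thesis by (simp add: d_def k1 add.commute)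
    qed
  qed
  have chain: "norm (w (d (m + l)) - w (d m)) \<le> 4 * B * (4 / 5) ^ m * (1 - (4 / 5) ^ l)" for l
  proof (induction l)
    case (Suc l)
    have "norm (w (d (m + Suc l)) - w (d m)) \<le> norm (w (d (Suc (m + l))) - w (d (m + l))) + norm (w (d (m + l)) - w (d m))"
      using norm_triangle_ineq[of "w (d (Suc (m + l))) - w (d (m + l))" "w (d (m + l)) - w (d m)"] by simp
    also have "\<dots> \<le> B * (4 / 5) ^ Suc (m + l) + 4 * B * (4 / 5) ^ m * (1 - (4 / 5) ^ l)"
      by (intro add_mono step Suc.IH)
    also have "\<dots> = 4 * B * (4 / 5) ^ m * (1 - (4 / 5) ^ Suc l)" by (simp add: power_add algebra_simps)
    finally show ?case .
  qed simp
  have "d \<longlonglongrightarrow> t"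
  proof (rule tendsto_sandwich[of "\<lambda>i. t - (1 / 2) ^ i" _ _ "\<lambda>_. t"])
    have "t - (1 / 2) ^ i = (t * 2 ^ i - 1) / 2 ^ i" for i by (simp add: diff_divide_distrib power_one_over)
    then have "t - (1 / 2) ^ i \<le> d i" for i
      using divide_right_mono[of "t * 2 ^ i - 1" "real (k i)" "2 ^ i"] k(2)[of i] by (simp add: d_def)
    moreover have "d i \<le> t" for i
      using k(1)[of i] by (simp add: d_def pos_divide_le_eq)
    ultimately show "\<forall>\<^sub>F i in sequentially. t - (1 / 2) ^ i \<le> d i" "\<forall>\<^sub>F i in sequentially. d i \<le> t" by auto
    show "(\<lambda>i. t - (1 / 2) ^ i) \<longlonglongrightarrow> t"
      using tendsto_diff[OF tendsto_const[of t] LIMSEQ_power_zero[of "1 / 2 :: real"]] by simp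
  qed simp
  then have "(\<lambda>l. d (m + l)) \<longlonglongrightarrow> t" by (subst add.commute) (rule LIMSEQ_ignore_initial_segment)
  then have "(\<lambda>l. w (d (m + l))) \<longlonglongrightarrow> w t"
    by (rule continuous_on_tendsto_compose[OF w]) (use t in \<open>auto simp: d_def\<close>)
  then have "(\<lambda>l. norm (w (d (m + l)) - w (d m))) \<longlonglongrightarrow> norm (w t - w (d m))" by (intro tendsto_intros)
  moreover have "norm (w (d (m + l)) - w (d m)) \<le> 4 * B * (4 / 5) ^ m" for l
    by (rule order_trans[OF chain], rule mult_left_le) (use B in auto)
  ultimately have "norm (w t - w (d m)) \<le> 4 * B * (4 / 5) ^ m" by (intro LIMSEQ_le_const2) auto
  then show ?thesis by (simp only: d_def k_def)
qed

text \<open>Times at distance at most 2^(-m) lie in the same or adjacent cells of level m. Two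
  chains and one increment give 4 + 4 + 1 = 9.\<close>

lemma dyadic_modulus:
  fixes w :: "real \<Rightarrow> 'b::real_normed_vector"
  assumes w: "continuous_on {0..} w" and B: "0 \<le> B"
    and inc: "\<And>m j. j < J * 2 ^ m \<Longrightarrow> norm (w ((real j + 1) / 2 ^ m) - w (real j / 2 ^ m)) \<le> B * (4 / 5) ^ m"
    and t: "0 \<le> t" "t \<le> s" "s < real J" "s \<le> t + 1 / 2 ^ m"
  shows "norm (w t - w s) \<le> 9 * B * (4 / 5) ^ m"
proof -
  define k k' where "k = nat \<lfloor>t * 2 ^ m\<rfloor>" and "k' = nat \<lfloor>s * 2 ^ m\<rfloor>"
  have 1: "norm (w t - w (real k / 2 ^ m)) \<le> 4 * B * (4 / 5) ^ m"
    unfolding k_def by (rule dyadic_chaining[OF w B inc]) (use t in auto)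
  have 2: "norm (w s - w (real k' / 2 ^ m)) \<le> 4 * B * (4 / 5) ^ m"
    unfolding k'_def by (rule dyadic_chaining[OF w B inc]) (use t in auto)
  have kk: "real k \<le> t * 2 ^ m" "t * 2 ^ m < real k + 1" "real k' \<le> s * 2 ^ m" "s * 2 ^ m < real k' + 1"
    using t by (auto simp: k_def k'_def)
  have ts: "t * 2 ^ m \<le> s * 2 ^ m" "s * 2 ^ m \<le> t * 2 ^ m + 1" "s * 2 ^ m < real J * 2 ^ m"
    using t by (auto simp: field_simps)
  have "real k < real k' + 1" "real k' < real k + 2" "real k < real J * 2 ^ m" using kk ts by linarith+
  then have "real k < real (k' + 1)" "real k' < real (k + 2)" "real k < real (J * 2 ^ m)" by auto
  then have "k' = k \<or> k' = k + 1" and kJ: "k < J * 2 ^ m" unfolding of_nat_less_iff by auto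
  then have 3: "norm (w (real k' / 2 ^ m) - w (real k / 2 ^ m)) \<le> B * (4 / 5) ^ m"
    using inc[OF kJ] B by (auto simp: add.commute)
  have "w t - w s = (w t - w (real k / 2 ^ m)) - (w s - w (real k' / 2 ^ m)) - (w (real k' / 2 ^ m) - w (real k / 2 ^ m))"
    by simp
  also have "norm \<dots> \<le> norm (w t - w (real k / 2 ^ m)) + norm (w s - w (real k' / 2 ^ m)) + norm (w (real k' / 2 ^ m) - w (real k / 2 ^ m))"
    by (rule order_trans[OF norm_triangle_ineq4 add_right_mono[OF norm_triangle_ineq4]])
  finally show ?thesis using 1 2 3 by simp
qed

text \<open>B, a root of the Hoelder sum, bounds all weighted increments. Take the first level m at
  which the modulus drops below \<theta>; its minimality bounds (5/4)^m by a multiple of B + 1.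
  Since 4 \<le> (5/4)^8, the inverse square 4^m of the scale costs an eighth power, and its n-th
  power brings back B^(8n), the Hoelder sum itself.\<close>

lemma modulus_scale:
  fixes w :: "real \<Rightarrow> 'b::real_normed_vector"
  assumes \<theta>: "\<theta> > 0" and n: "n \<ge> 1" and T: "T + 1 < real J" and w: "continuous_on {0..} w"
    and fin: "hoelder_sum (8 * n) J w < \<infinity>"
  shows "\<exists>\<delta>>0. (\<forall>s t. 0 \<le> t \<longrightarrow> t \<le> T \<longrightarrow> t \<le> s \<longrightarrow> s \<le> t + \<delta> \<longrightarrow> norm (w t - w s) \<le> \<theta>) \<and>
     (1 + 1 / \<delta>\<^sup>2) ^ n \<le> 2 ^ n * (2 * (1 + 12 / \<theta>)) ^ (8 * n) * (1 + enn2real (hoelder_sum (8 * n) J w))"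
proof -
  define y where "y = enn2real (hoelder_sum (8 * n) J w)"
  have y: "hoelder_sum (8 * n) J w = ennreal y" "0 \<le> y" using fin by (auto simp: y_def)
  define B where "B = root (8 * n) y"
  have B: "0 \<le> B" "B ^ (8 * n) = y" using n y by (auto simp: B_def)
  have inc: "norm (w ((real j + 1) / 2 ^ m) - w (real j / 2 ^ m)) \<le> B * (4 / 5) ^ m" if j: "j < J * 2 ^ m" for m j
  proof -
    let ?f = "\<lambda>m j. ennreal (((5 / 4) ^ m * norm (w ((real j + 1) / 2 ^ m) - w (real j / 2 ^ m))) ^ (8 * n))"
    have "?f m j \<le> (\<Sum>j<J * 2 ^ m. ?f m j)" by (rule member_le_sum) (use j in auto)
    also have "\<dots> \<le> hoelder_sum (8 * n) J w"
      unfolding hoelder_sum_def using sum_le_suminf[of "\<lambda>m. \<Sum>j<J * 2 ^ m. ?f m j" "{m}"] by simp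
    finally have "((5 / 4) ^ m * norm (w ((real j + 1) / 2 ^ m) - w (real j / 2 ^ m))) ^ (8 * n) \<le> B ^ (8 * n)"
      using y B by (simp add: ennreal_le_iff)
    then have "(5 / 4) ^ m * norm (w ((real j + 1) / 2 ^ m) - w (real j / 2 ^ m)) \<le> B"
      using B n by (subst (asm) power_mono_iff) auto
    from mult_left_mono[OF this, of "(4 / 5) ^ m"] show ?thesis
      by (simp add: mult.assoc[symmetric] mult.commute flip: power_mult_distrib)
  qed
  \<comment> \<open>B + 1 keeps A positive even when all increments vanish.\<close>
  define A where "A = 9 * (B + 1) / \<theta>"
  have A: "A > 0" using B \<theta> by (simp add: A_def)
  have "\<exists>m. A * (4 / 5) ^ m \<le> 1"
  proof -
    obtain m where "(4 / 5 :: real) ^ m < 1 / A" using real_arch_pow_inv[of "1 / A" "4 / 5"] A by auto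
    then show ?thesis using A by (intro exI[of _ m]) (simp add: field_simps)
  qed
  then obtain m where m: "A * (4 / 5) ^ m \<le> 1" and least: "\<And>i. i < m \<Longrightarrow> \<not> A * (4 / 5) ^ i \<le> 1"
    using exists_least_iff[of "\<lambda>m. A * (4 / 5) ^ m \<le> 1"] by blast
  \<comment> \<open>The 1 covers m = 0; otherwise level m - 1 fails and gives (5/4)^m < 5/4 A.
    Rounding 5/4 up to 4/3 turns the 9 in A into 12.\<close>
  have m5: "(5 / 4) ^ m \<le> 1 + 4 / 3 * A"
  proof (cases m)
    case (Suc i)
    then have "1 < A * (4 / 5) ^ i" using least[of i] by simp
    from mult_strict_right_mono[OF this, of "(5 / 4) ^ i"]
    have "(5 / 4) ^ i < A" by (simp add: mult.assoc flip: power_mult_distrib)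
    then show ?thesis using Suc A by simp
  qed (use A in simp)
  have pow4: "(4::real) ^ m \<le> (1 + 12 / \<theta> * (B + 1)) ^ 8"
  proof -
    have "(4::real) ^ m \<le> ((5 / 4) ^ 8) ^ m" by (intro power_mono) (auto simp: power_divide)
    also have "\<dots> = ((5 / 4) ^ m) ^ 8" by (simp add: mult.commute flip: power_mult)
    also have "\<dots> \<le> (1 + 4 / 3 * A) ^ 8" using m5 by (intro power_mono) auto
    also have "1 + 4 / 3 * A = 1 + 12 / \<theta> * (B + 1)" using \<theta> by (simp add: A_def field_simps)
    finally show ?thesis .
  qed
  show ?thesis
  proof (intro exI[of _ "1 / 2 ^ m"] conjI allI impI)
    fix s t :: real assume st: "0 \<le> t" "t \<le> T" "t \<le> s" "s \<le> t + 1 / 2 ^ m"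
    \<comment> \<open>The scale never exceeds 1, so s stays below T + 1 and within the range covered
      by the Hoelder sum.\<close>
    have "1 / 2 ^ m \<le> (1::real)" by simp
    then have "s < real J" using st T by linarith
    then have "norm (w t - w s) \<le> 9 * B * (4 / 5) ^ m" using st by (intro dyadic_modulus[OF w B(1) inc]) auto
    also have "\<dots> \<le> 9 * (B + 1) * (4 / 5) ^ m" by (intro mult_right_mono) auto
    also have "\<dots> = \<theta> * (A * (4 / 5) ^ m)" using \<theta> by (simp add: A_def)
    also have "\<dots> \<le> \<theta> * 1" using m \<theta> by (intro mult_left_mono) auto
    finally show "norm (w t - w s) \<le> \<theta>" by simp
  next
    define c where "c = 1 + 12 / \<theta>"
    have c: "c \<ge> 1" using \<theta> by (simp add: c_def)
    have "1 + 12 / \<theta> * (B + 1) \<le> c * (B + 1)" using B by (simp add: c_def algebra_simps)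
    then have "(1 + 12 / \<theta> * (B + 1)) ^ 8 \<le> (c * (B + 1)) ^ 8" using B \<theta> by (intro power_mono) auto
    then have 4: "4 ^ m \<le> (c * (B + 1)) ^ 8" using pow4 by simp
    have "1 \<le> c * (B + 1)" using mult_mono[of 1 c 1 "B + 1"] c B by simp
    then have "1 \<le> (c * (B + 1)) ^ 8" by (rule one_le_power)
    then have "1 + 4 ^ m \<le> 2 * (c * (B + 1)) ^ 8" using 4 by simp
    moreover have "1 / (1 / 2 ^ m)\<^sup>2 = (4::real) ^ m" by (simp add: power_one_over power2_eq_square flip: power_mult_distrib)
    ultimately have "(1 + 1 / (1 / 2 ^ m)\<^sup>2) ^ n \<le> (2 * (c * (B + 1)) ^ 8) ^ n" by (intro power_mono) auto
    also have "\<dots> = 2 ^ n * (c ^ (8 * n) * (B + 1) ^ (8 * n))" by (simp add: power_mult_distrib flip: power_mult)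
    also have "\<dots> \<le> 2 ^ n * (c ^ (8 * n) * (2 ^ (8 * n) * (1 + y)))"
    proof (intro mult_left_mono)
      have "(B + 1) ^ (8 * n) \<le> (2 * max B 1) ^ (8 * n)" using B by (intro power_mono) auto
      also have "\<dots> = 2 ^ (8 * n) * max B 1 ^ (8 * n)" by (rule power_mult_distrib)
      also have "max B 1 ^ (8 * n) \<le> 1 + y" using B y by (cases "B \<le> 1") auto
      finally show "(B + 1) ^ (8 * n) \<le> 2 ^ (8 * n) * (1 + y)" by simp
    qed (use c in auto)
    finally show "(1 + 1 / (1 / 2 ^ m)\<^sup>2) ^ n \<le> 2 ^ n * (2 * (1 + 12 / \<theta>)) ^ (8 * n) * (1 + enn2real (hoelder_sum (8 * n) J w))"
      unfolding y_def[symmetric] c_def[symmetric] by (simp add: power_mult_distrib mult_ac)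
  qed simp
qed

section \<open>Convergence\<close>

text \<open>By path continuity the supremum is already attained as the supremum over the rationals
  of the open interval, a countable dense set.\<close>

lemma SUP_Icc_measurable:
  fixes f :: "real \<Rightarrow> 'a \<Rightarrow> real"
  assumes meas: "\<And>t. f t \<in> borel_measurable M" and T: "T > 0"
    and cont: "\<And>\<omega>. \<omega> \<in> space M \<Longrightarrow> continuous_on {0..} (\<lambda>t. f t \<omega>)"
  shows "(\<lambda>\<omega>. SUP t\<in>{0..T}. f t \<omega>) \<in> borel_measurable M"
proof -
  define D where "D = {0<..<T} \<inter> \<rat>"
  have cl: "closure D = {0..T}"
    unfolding D_def using T by (subst closure_open_Int_superset) (auto simp: Rats_closure_real)
  then have D: "D \<noteq> {}" using T by force
  have DT: "D \<subseteq> {0..T}" by (auto simp: D_def)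
  have c: "countable D" by (auto simp: D_def countable_rat intro: countable_Int2)
  have cT: "continuous_on {0..T} (\<lambda>t. f t \<omega>)" if "\<omega> \<in> space M" for \<omega>
    by (rule continuous_on_subset[OF cont[OF that]]) auto
  have bdd: "bdd_above ((\<lambda>t. f t \<omega>) ` {0..T})" if "\<omega> \<in> space M" for \<omega>
    by (intro bounded_imp_bdd_above compact_imp_bounded compact_continuous_image cT that compact_Icc)
  have bddD: "bdd_above ((\<lambda>t. f t \<omega>) ` D)" if "\<omega> \<in> space M" for \<omega>
    by (rule bdd_above_mono[OF bdd[OF that]]) (use DT in auto)
  have "(SUP t\<in>{0..T}. f t \<omega>) = (SUP t\<in>D. f t \<omega>)" if \<omega>: "\<omega> \<in> space M" for \<omega>
  proof (rule antisym)
    show "(SUP t\<in>{0..T}. f t \<omega>) \<le> (SUP t\<in>D. f t \<omega>)"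
    proof (rule cSUP_least)
      fix t assume "t \<in> {0..T}"
      then show "f t \<omega> \<le> (SUP t\<in>D. f t \<omega>)"
        using continuous_le_on_closure[of D "\<lambda>t. f t \<omega>" t "SUP t\<in>D. f t \<omega>"] cT[OF \<omega>] cSUP_upper[OF _ bddD[OF \<omega>]]
        by (simp add: cl)
    qed (use T in auto)
    show "(SUP t\<in>D. f t \<omega>) \<le> (SUP t\<in>{0..T}. f t \<omega>)"
      by (rule cSUP_subset_mono[OF D bdd[OF \<omega>] DT]) simp
  qed
  moreover have "(\<lambda>\<omega>. SUP t\<in>D. f t \<omega>) \<in> borel_measurable M"
    by (rule borel_measurable_cSUP[OF c meas bddD])
  ultimately show ?thesis by (simp cong: measurable_cong)
qed

lemma solvesD:
  assumes "solves M vel F S W q0 p0 q p"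
  shows "q t \<in> borel_measurable M" "p t \<in> borel_measurable M"
    and "\<omega> \<in> space M \<Longrightarrow> continuous_on {0..} (\<lambda>t. q t \<omega>)"
    and "\<omega> \<in> space M \<Longrightarrow> continuous_on {0..} (\<lambda>t. p t \<omega>)"
  using assms unfolding solves_def by blast+

text \<open>Each \<epsilon> has its own exceptional null set. Along a sequence there are countably
  many, so a single null set is discarded and the deterministic stability applies to every remaining
  noise path.\<close>

lemma solutions_converge_AE:
  fixes W :: "real \<Rightarrow> 'a \<Rightarrow> 'v::euclidean_space"
  assumes S: "open S" and F: "loc_lip S F" and W0: "\<And>\<omega>. \<omega> \<in> space M \<Longrightarrow> W 0 \<omega> = 0" and T: "T \<ge> 0"
    and sol: "solves M (\<lambda>x. x) F S W q0 p0 q p"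
    and sole: "\<And>\<epsilon>. \<epsilon> \<in> {0<..<1} \<Longrightarrow> solves M (vel \<epsilon>) F S W q0 p0 (qe \<epsilon>) (pe \<epsilon>)"
    and vel: "\<And>\<epsilon> x y. \<epsilon> \<in> {0<..<1} \<Longrightarrow> norm (vel \<epsilon> x - vel \<epsilon> y) \<le> norm (x - y)"
    and vel_id: "\<And>\<epsilon> x. \<epsilon> \<in> {0<..<1} \<Longrightarrow> norm (vel \<epsilon> x - x) \<le> C * \<epsilon> * norm x ^ 3"
    and X: "\<And>i::nat. 0 < X i" "\<And>i. X i < 1" "X \<longlonglongrightarrow> 0"
  shows "AE \<omega> in M. \<forall>\<xi>>0. \<forall>\<^sub>F i in sequentially. \<forall>t\<in>{0..T}.
           norm (qe (X i) t \<omega> - q t \<omega>) + norm (pe (X i) t \<omega> - p t \<omega>) < \<xi>"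
proof -
  have "AE \<omega> in M. \<forall>i. path_sol (vel (X i)) F S (\<lambda>t. W t \<omega>) q0 p0 (\<lambda>t. qe (X i) t \<omega>) (\<lambda>t. pe (X i) t \<omega>)"
    unfolding AE_all_countable using X by (auto intro!: solves_path_sol sole)
  with solves_path_sol[OF sol] AE_space show ?thesis
  proof eventually_elim
    case (elim \<omega>)
    show ?case
    proof (intro allI impI)
      fix \<xi> :: real assume \<xi>: "\<xi> > 0"
      obtain \<delta> where \<delta>: "\<delta> > 0" "\<And>\<epsilon> q' p' t. 0 < \<epsilon> \<Longrightarrow> \<epsilon> < \<delta> \<Longrightarrow> \<epsilon> < 1 \<Longrightarrow>
          path_sol (vel \<epsilon>) F S (\<lambda>t. W t \<omega>) q0 p0 q' p' \<Longrightarrow> t \<in> {0..T} \<Longrightarrow>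
          norm (q' t - q t \<omega>) + norm (p' t - p t \<omega>) < \<xi>"
        using path_sol_stable[OF S F W0[OF elim(2)] T \<xi> elim(1) vel vel_id] by blast
      have "\<forall>\<^sub>F i in sequentially. X i < \<delta>" using order_tendstoD(2)[OF X(3) \<delta>(1)] .
      then show "\<forall>\<^sub>F i in sequentially. \<forall>t\<in>{0..T}.
          norm (qe (X i) t \<omega> - q t \<omega>) + norm (pe (X i) t \<omega> - p t \<omega>) < \<xi>"
      proof eventually_elim
        case (elim i)
        then show ?case using \<delta>(2)[OF X(1) _ X(2)] \<open>\<forall>i. path_sol _ _ _ _ _ _ _ _\<close> by blast
      qed
    qed
  qed
qed

text \<open>The probability is the integral of an indicator that is eventually 0 on almost every
  path, so dominated convergence with bound 1 suffices. Testing along sequences in (0,1) makes the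
  almost sure statement available.\<close>

lemma converge_in_probability:
  fixes W :: "real \<Rightarrow> 'a \<Rightarrow> 'v::euclidean_space"
  assumes M: "prob_space M"
    and S: "open S" and F: "loc_lip S F" and W0: "\<And>\<omega>. \<omega> \<in> space M \<Longrightarrow> W 0 \<omega> = 0" and T: "T > 0"
    and sol: "solves M (\<lambda>x. x) F S W q0 p0 q p"
    and sole: "\<And>\<epsilon>. \<epsilon> \<in> {0<..<1} \<Longrightarrow> solves M (vel \<epsilon>) F S W q0 p0 (qe \<epsilon>) (pe \<epsilon>)"
    and vel: "\<And>\<epsilon> x y. \<epsilon> \<in> {0<..<1} \<Longrightarrow> norm (vel \<epsilon> x - vel \<epsilon> y) \<le> norm (x - y)"
    and vel_id: "\<And>\<epsilon> x. \<epsilon> \<in> {0<..<1} \<Longrightarrow> norm (vel \<epsilon> x - x) \<le> C * \<epsilon> * norm x ^ 3"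
    and \<xi>: "\<xi> > 0"
  shows "((\<lambda>\<epsilon>. prob_space.prob M {\<omega> \<in> space M.
      (SUP t\<in>{0..T}. norm (qe \<epsilon> t \<omega> - q t \<omega>) + norm (pe \<epsilon> t \<omega> - p t \<omega>)) > \<xi>}) \<longlongrightarrow> 0) (at_right 0)"
proof (rule tendsto_at_right_sequentially[of 0 1])
  interpret prob_space M by fact
  fix X :: "nat \<Rightarrow> real" assume X: "\<And>i. 0 < X i" "\<And>i. X i < 1" "X \<longlonglongrightarrow> 0"
  let ?d = "\<lambda>i t \<omega>. norm (qe (X i) t \<omega> - q t \<omega>) + norm (pe (X i) t \<omega> - p t \<omega>)"
  define A where "A = (\<lambda>i. {\<omega> \<in> space M. (SUP t\<in>{0..T}. ?d i t \<omega>) > \<xi>})"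
  have soli: "solves M (vel (X i)) F S W q0 p0 (qe (X i)) (pe (X i))" for i by (rule sole) (use X in auto)
  note [measurable] = solvesD(1,2)[OF sol] solvesD(1,2)[OF soli]
  have "(\<lambda>\<omega>. SUP t\<in>{0..T}. ?d i t \<omega>) \<in> borel_measurable M" for i
    by (rule SUP_Icc_measurable[OF _ T]) (auto intro!: continuous_intros solvesD[OF sol] solvesD[OF soli])
  then have A [measurable]: "A i \<in> sets M" for i unfolding A_def by measurable
  have "(\<lambda>i. \<integral>\<omega>. indicat_real (A i) \<omega> \<partial>M) \<longlonglongrightarrow> (\<integral>\<omega>. 0 \<partial>M)"
  proof (rule integral_dominated_convergence[where w = "\<lambda>_. 1"])
    have "AE \<omega> in M. \<forall>\<xi>>0. \<forall>\<^sub>F i in sequentially. \<forall>t\<in>{0..T}. ?d i t \<omega> < \<xi>"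
      by (rule solutions_converge_AE[OF S F W0 _ sol sole vel vel_id X]) (use T in auto)
    then show "AE \<omega> in M. (\<lambda>i. indicat_real (A i) \<omega>) \<longlonglongrightarrow> 0"
    proof eventually_elim
      case (elim \<omega>)
      with \<xi> have "\<forall>\<^sub>F i in sequentially. \<forall>t\<in>{0..T}. ?d i t \<omega> < \<xi>" by blast
      then have "\<forall>\<^sub>F i in sequentially. indicat_real (A i) \<omega> = 0"
      proof eventually_elim
        case (elim i)
        \<comment> \<open>Strictness is lost in the supremum, which is enough because the event asks
          for a value strictly above \<xi>.\<close>
        then have "(SUP t\<in>{0..T}. ?d i t \<omega>) \<le> \<xi>" using T by (intro cSUP_least) (auto intro: less_imp_le)
        then show ?case by (simp add: A_def)
      qed
      then show ?case by (rule tendsto_eventually)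
    qed
  qed (auto split: split_indicator)
  then have "(\<lambda>i. prob (A i)) \<longlonglongrightarrow> 0" by simp
  then show "(\<lambda>i. prob {\<omega> \<in> space M. (SUP t\<in>{0..T}. ?d i t \<omega>) > \<xi>}) \<longlonglongrightarrow> 0"
    unfolding A_def .
qed simp

context singular_potential
begin

text \<open>The scale \<delta> is read off the Brownian path alone, so the a priori bound holds with
  the same \<delta> for both solutions, and the n-th powers are dominated by an affine function of
  the integrable Hoelder sum.\<close>

lemma converge_in_mean:
  fixes W :: "real \<Rightarrow> 'a \<Rightarrow> 'v"
  assumes lipU: "loc_lip UNIV gradU" and lipG: "loc_lip (-{0}) gradG"
    and bm: "std_BM M W" and T: "T > 0" and n: "n \<ge> 1"
    and sol: "solves M (\<lambda>x. x) (\<lambda>x. gradU x + gradG x) (-{0}) W q0 p0 q p"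
    and sole: "\<And>\<epsilon>. \<epsilon> \<in> {0<..<1} \<Longrightarrow> solves M (vel \<epsilon>) (\<lambda>x. gradU x + gradG x) (-{0}) W q0 p0 (qe \<epsilon>) (pe \<epsilon>)"
    and kin: "\<And>\<epsilon>. \<epsilon> \<in> {0<..<1} \<Longrightarrow> kinetic (vel \<epsilon>) (K \<epsilon>)"
    and vel_id: "\<And>\<epsilon> x. \<epsilon> \<in> {0<..<1} \<Longrightarrow> norm (vel \<epsilon> x - x) \<le> C * \<epsilon> * norm x ^ 3"
  shows "((\<lambda>\<epsilon>. \<integral>\<^sup>+ \<omega>. ennreal (SUP t\<in>{0..T}. norm (qe \<epsilon> t \<omega> - q t \<omega>) ^ n
             + norm (pe \<epsilon> t \<omega> - p t \<omega>) ^ n) \<partial>M) \<longlongrightarrow> 0) (at_right 0)"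
proof (rule tendsto_at_right_sequentially[of 0 1])
  interpret prob_space M by (rule std_BM_D[OF bm])
  let ?F = "\<lambda>x. gradU x + gradG x"
  fix X :: "nat \<Rightarrow> real" assume X: "\<And>i. 0 < X i" "\<And>i. X i < 1" "X \<longlonglongrightarrow> 0"
  have S: "open (- {0::'v})" by auto
  have U': "loc_lip (-{0}) gradU"
    using loc_lip_comp_linear[OF lipU bounded_linear_ident, of "-{0}"] by simp
  have F: "loc_lip (-{0}) ?F" by (rule loc_lip_add[OF U' lipG])
  have soli: "solves M (vel (X i)) ?F (-{0}) W q0 p0 (qe (X i)) (pe (X i))" for i by (rule sole) (use X in auto)
  have kini: "kinetic (vel (X i)) (K (X i))" for i by (rule kin) (use X in auto)
  have vel: "norm (vel \<epsilon> x - vel \<epsilon> y) \<le> norm (x - y)" if "\<epsilon> \<in> {0<..<1}" for \<epsilon> x y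
    using kin[OF that] unfolding kinetic_def by blast
  note [measurable] = solvesD(1,2)[OF sol] solvesD(1,2)[OF soli]
  obtain \<theta> B where \<theta>: "0 < \<theta>" and B: "0 \<le> B" and bound: "\<And>v K w \<delta> q p t. kinetic v K \<Longrightarrow> continuous_on {0..} w \<Longrightarrow> w 0 = 0 \<Longrightarrow>
     0 < \<delta> \<Longrightarrow>
     (\<forall>s t. 0 \<le> t \<longrightarrow> t \<le> T \<longrightarrow> t \<le> s \<longrightarrow> s \<le> t + \<delta> \<longrightarrow> norm (w t - w s) \<le> \<theta>) \<Longrightarrow>
     path_sol v ?F (-{0}) w q0 p0 q p \<Longrightarrow> t\<in>{0..T} \<Longrightarrow>
     norm (q t) \<le> B * (1 + 1 / \<delta>\<^sup>2) \<and> norm (p t) \<le> B * (1 + 1 / \<delta>\<^sup>2)"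
    using apriori_bound[OF T loc_lip_continuous_on[OF lipU open_UNIV] loc_lip_continuous_on[OF lipG S], of q0 p0]
    by (elim exE conjE) (rule that; blast)
  obtain J :: nat where J: "T + 1 < real J" using reals_Archimedean2 by blast
  define Y where "Y = (\<lambda>\<omega>. hoelder_sum (8 * n) J (\<lambda>t. W t \<omega>))"
  have Y [measurable]: "Y \<in> borel_measurable M"
    unfolding Y_def by (rule hoelder_sum_measurable) (rule std_BM_D[OF bm])
  have Yint: "(\<integral>\<^sup>+\<omega>. Y \<omega> \<partial>M) < \<infinity>" unfolding Y_def by (rule hoelder_sum_integrable[OF bm n])
  \<comment> \<open>Finiteness lets \<open>enn2real\<close> below recover the Hoelder sum instead of
    its default value 0.\<close>
  then have Yfin: "AE \<omega> in M. Y \<omega> \<noteq> \<infinity>" by (intro nn_integral_PInf_AE) auto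
  \<comment> \<open>The 2 counts position and momentum, 2 B comes from the triangle inequality, and
    the last factor is that of \<open>modulus_scale\<close>.\<close>
  define c where "c = 2 * (2 * B) ^ n * (2 ^ n * (2 * (1 + 12 / \<theta>)) ^ (8 * n))"
  have c: "0 \<le> c" using B \<theta> by (simp add: c_def)
  let ?d = "\<lambda>i t \<omega>. norm (qe (X i) t \<omega> - q t \<omega>) ^ n + norm (pe (X i) t \<omega> - p t \<omega>) ^ n"
  have meas: "(\<lambda>\<omega>. SUP t\<in>{0..T}. ?d i t \<omega>) \<in> borel_measurable M" for i
    by (rule SUP_Icc_measurable[OF _ T]) (auto intro!: continuous_intros solvesD[OF sol] solvesD[OF soli])
  have "(\<lambda>i. \<integral>\<^sup>+ \<omega>. ennreal (SUP t\<in>{0..T}. ?d i t \<omega>) \<partial>M) \<longlonglongrightarrow> (\<integral>\<^sup>+ \<omega>. 0 \<partial>M)"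
  proof (rule nn_integral_dominated_convergence[where w = "\<lambda>\<omega>. ennreal c * (1 + Y \<omega>)"])
    show "(\<lambda>\<omega>. ennreal (SUP t\<in>{0..T}. ?d i t \<omega>)) \<in> borel_measurable M" for i using meas by measurable
    show "(\<integral>\<^sup>+ \<omega>. ennreal c * (1 + Y \<omega>) \<partial>M) < \<infinity>"
      using Yint by (simp add: nn_integral_cmult nn_integral_add emeasure_space_1 ennreal_mult_less_top)
    show "AE \<omega> in M. ennreal (SUP t\<in>{0..T}. ?d i t \<omega>) \<le> ennreal c * (1 + Y \<omega>)" for i
      using Yfin AE_space solves_path_sol[OF sol] solves_path_sol[OF soli[of i]]
    proof eventually_elim
      case (elim \<omega>)
      let ?w = "\<lambda>t. W t \<omega>"
      define y where "y = enn2real (Y \<omega>)"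
      have y: "Y \<omega> = ennreal y" "0 \<le> y" using elim(1) by (auto simp: y_def top.not_eq_extremum)
      have cw: "continuous_on {0..} ?w" "?w 0 = 0" using std_BM_D[OF bm] elim(2) by auto
      obtain \<delta> where \<delta>: "\<delta> > 0" "\<forall>s t. 0 \<le> t \<longrightarrow> t \<le> T \<longrightarrow> t \<le> s \<longrightarrow> s \<le> t + \<delta> \<longrightarrow> norm (?w t - ?w s) \<le> \<theta>"
        and le: "(1 + 1 / \<delta>\<^sup>2) ^ n \<le> 2 ^ n * (2 * (1 + 12 / \<theta>)) ^ (8 * n) * (1 + y)"
        using modulus_scale[OF \<theta> n J cw(1)] elim(1) unfolding y_def Y_def by (auto simp: top.not_eq_extremum)
      have "?d i t \<omega> \<le> c * (1 + y)" if t: "t \<in> {0..T}" for t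
      proof -
        define x where "x = 1 + 1 / \<delta>\<^sup>2"
        have x: "x \<ge> 0" by (simp add: x_def)
        have "norm (q t \<omega>) \<le> B * x \<and> norm (p t \<omega>) \<le> B * x"
          unfolding x_def by (rule bound[OF kinetic_id cw \<delta> elim(3) t])
        moreover have "norm (qe (X i) t \<omega>) \<le> B * x \<and> norm (pe (X i) t \<omega>) \<le> B * x"
          unfolding x_def by (rule bound[OF kini cw \<delta> elim(4) t])
        ultimately have "norm (qe (X i) t \<omega> - q t \<omega>) \<le> 2 * B * x" "norm (pe (X i) t \<omega> - p t \<omega>) \<le> 2 * B * x"
          using norm_triangle_ineq4[of "qe (X i) t \<omega>" "q t \<omega>"] norm_triangle_ineq4[of "pe (X i) t \<omega>" "p t \<omega>"] by linarith+
        then have "?d i t \<omega> \<le> (2 * B * x) ^ n + (2 * B * x) ^ n" by (intro add_mono power_mono) auto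
        also have "\<dots> = 2 * (2 * B) ^ n * x ^ n" by (simp add: power_mult_distrib)
        also have "\<dots> \<le> 2 * (2 * B) ^ n * (2 ^ n * (2 * (1 + 12 / \<theta>)) ^ (8 * n) * (1 + y))"
          using le B unfolding x_def by (intro mult_left_mono) auto
        finally show ?thesis by (simp add: c_def mult.assoc)
      qed
      then have "(SUP t\<in>{0..T}. ?d i t \<omega>) \<le> c * (1 + y)" using T by (intro cSUP_least) auto
      then have "ennreal (SUP t\<in>{0..T}. ?d i t \<omega>) \<le> ennreal (c * (1 + y))" by (rule ennreal_leI)
      also have "\<dots> = ennreal c * (1 + Y \<omega>)" using c y by (simp add: ennreal_mult)
      finally show ?case .
    qed
    have "AE \<omega> in M. \<forall>\<xi>>0. \<forall>\<^sub>F i in sequentially. \<forall>t\<in>{0..T}.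
        norm (qe (X i) t \<omega> - q t \<omega>) + norm (pe (X i) t \<omega> - p t \<omega>) < \<xi>"
      by (rule solutions_converge_AE[OF S F _ _ sol sole vel vel_id X]) (use T std_BM_D[OF bm] in auto)
    then show "AE \<omega> in M. (\<lambda>i. ennreal (SUP t\<in>{0..T}. ?d i t \<omega>)) \<longlonglongrightarrow> 0"
      using AE_space
    proof eventually_elim
      case (elim \<omega>)
      have "(\<lambda>i. SUP t\<in>{0..T}. ?d i t \<omega>) \<longlonglongrightarrow> 0"
      proof (rule order_tendstoI)
        fix a :: real assume a: "a < 0"
        have "0 \<le> (SUP t\<in>{0..T}. ?d i t \<omega>)" for i
        \<comment> \<open>The value at time 0 is nonnegative; boundedness is checked because a real
          supremum is meaningful only for sets bounded above.\<close>
        proof (rule cSUP_upper2[of _ _ 0])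
          have "continuous_on {0..T} (\<lambda>t. ?d i t \<omega>)"
            using solvesD(3,4)[OF sol elim(2)] solvesD(3,4)[OF soli[of i] elim(2)]
            by (auto intro!: continuous_intros elim: continuous_on_subset)
          then show "bdd_above ((\<lambda>t. ?d i t \<omega>) ` {0..T})"
            by (intro bounded_imp_bdd_above compact_imp_bounded compact_continuous_image compact_Icc)
        qed (use T in auto)
        then show "\<forall>\<^sub>F i in sequentially. a < (SUP t\<in>{0..T}. ?d i t \<omega>)"
          by (intro always_eventually allI) (rule less_le_trans[OF a])
      next
        fix a :: real assume a: "0 < a"
        \<comment> \<open>At most 1, so that n-th powers do not exceed \<xi>; at most a/4, so that
          the two summands stay strictly below a.\<close>
        define \<xi> where "\<xi> = min 1 (a / 4)"
        have \<xi>: "0 < \<xi>" "\<xi> \<le> 1" "2 * \<xi> < a" using a by (auto simp: \<xi>_def min_def)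
        have "\<forall>\<^sub>F i in sequentially. \<forall>t\<in>{0..T}.
            norm (qe (X i) t \<omega> - q t \<omega>) + norm (pe (X i) t \<omega> - p t \<omega>) < \<xi>" using elim(1) \<xi>(1) by blast
        then show "\<forall>\<^sub>F i in sequentially. (SUP t\<in>{0..T}. ?d i t \<omega>) < a"
        proof eventually_elim
          case (elim i)
          have pw: "z ^ n \<le> \<xi>" if "0 \<le> z" "z \<le> \<xi>" for z :: real
          proof -
            have "z ^ n \<le> z ^ 1" using that \<xi> n by (intro power_decreasing) auto
            then show ?thesis using that by simp
          qed
          have "?d i t \<omega> \<le> 2 * \<xi>" if "t \<in> {0..T}" for t
          proof -
            have "norm (qe (X i) t \<omega> - q t \<omega>) + norm (pe (X i) t \<omega> - p t \<omega>) < \<xi>" using elim that by blast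
            then have "norm (qe (X i) t \<omega> - q t \<omega>) \<le> \<xi>" "norm (pe (X i) t \<omega> - p t \<omega>) \<le> \<xi>"
              using norm_ge_zero[of "qe (X i) t \<omega> - q t \<omega>"] norm_ge_zero[of "pe (X i) t \<omega> - p t \<omega>"] by linarith+
            then have "norm (qe (X i) t \<omega> - q t \<omega>) ^ n \<le> \<xi>" "norm (pe (X i) t \<omega> - p t \<omega>) ^ n \<le> \<xi>"
              by (simp_all add: pw)
            then show ?thesis by simp
          qed
          then have "(SUP t\<in>{0..T}. ?d i t \<omega>) \<le> 2 * \<xi>" using T by (intro cSUP_least) auto
          then show ?case using \<xi> by simp
        qed
      qed
      from tendsto_ennrealI[OF this] show ?case by simp
    qed
  qed auto
  then show "(\<lambda>i. \<integral>\<^sup>+ \<omega>. ennreal (SUP t\<in>{0..T}. ?d i t \<omega>) \<partial>M) \<longlonglongrightarrow> 0" by simp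
qed simp

end

theorem theorem2p6:
  fixes U :: "real^'d \<Rightarrow> real" and gradU :: "real^'d \<Rightarrow> real^'d"
    and G :: "real^'d \<Rightarrow> real" and gradG :: "real^'d \<Rightarrow> real^'d"
    and a1 lam a2 a3 \<beta>1 \<beta>2 a4 a5 a6 :: real
  assumes U_smooth: "smooth_on UNIV U"
    and U_ge1: "\<forall>q. U q \<ge> 1"
    and U_grad: "\<forall>q. GDERIV U q :> gradU q"
    and a1_pos: "a1 > 0" and lam_ge1: "lam \<ge> 1" and a2_pos: "a2 > 0" and a3_pos: "a3 > 0"
    and U_bounds: "\<forall>q. (1 / a1) * norm q powr (lam + 1) - a1 \<le> \<bar>U q\<bar>
                      \<and> \<bar>U q\<bar> \<le> a1 * (1 + norm q powr (lam + 1))"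
    and gradU_bound: "\<forall>q. norm (gradU q) \<le> a1 * (1 + norm q powr lam)"
    and U_coercive: "\<forall>q. inner (gradU q) q \<ge> a2 * norm q powr (lam + 1) - a3"
    and G_smooth: "smooth_on (- {0}) G"
    and G_grad: "\<forall>q. q \<noteq> 0 \<longrightarrow> (GDERIV G q :> gradG q)"
    and G_sing: "filterlim G at_top (at 0)"
    and G_even: "\<forall>q. G (- q) = G q"
    and gradG_odd: "\<forall>q. q \<noteq> 0 \<longrightarrow> gradG (- q) = - gradG q"
    and beta1: "\<beta>1 \<ge> 1"
    and G_bound: "\<forall>q. q \<noteq> 0 \<longrightarrow> \<bar>G q\<bar> \<le> a1 * (1 + norm q + norm q powr (- \<beta>1))"
    and gradG_bound: "\<forall>q. q \<noteq> 0 \<longrightarrow> norm (gradG q) \<le> a1 * (1 + norm q powr (- \<beta>1))"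
    and beta2: "0 \<le> \<beta>2" "\<beta>2 < \<beta>1" and a4_pos: "a4 > 0" and a6_pos: "a6 > 0"
    and gradG_asym: "\<forall>q. q \<noteq> 0 \<longrightarrow>
        norm (gradG q + (a4 / norm q powr (\<beta>1 + 1)) *\<^sub>R q + (a5 / norm q powr (\<beta>2 + 1)) *\<^sub>R q) \<le> a6"
  shows
    "(\<forall>(M :: 'a measure) (W :: real \<Rightarrow> 'a \<Rightarrow> real^'d^'n) q0 p0
        (qe :: real \<Rightarrow> real \<Rightarrow> 'a \<Rightarrow> real^'d^'n) pe q p.
        CARD('n) \<ge> 2 \<longrightarrow> prob_space M \<longrightarrow> iid_BMs M W \<longrightarrow> q0 \<in> coll_free \<longrightarrow>
        (\<forall>\<epsilon>\<in>{0<..<1}. solves M (rel_vel_multi \<epsilon>) (force_multi gradU gradG) coll_free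
                                W q0 p0 (qe \<epsilon>) (pe \<epsilon>)) \<longrightarrow>
        solves M (\<lambda>P. P) (force_multi gradU gradG) coll_free W q0 p0 q p \<longrightarrow>
        (\<forall>T>0. \<forall>\<xi>>0.
           ((\<lambda>\<epsilon>. prob_space.prob M {\<omega> \<in> space M.
               (SUP t\<in>{0..T}. norm (qe \<epsilon> t \<omega> - q t \<omega>) + norm (pe \<epsilon> t \<omega> - p t \<omega>)) > \<xi>})
             \<longlongrightarrow> 0) (at_right 0)))
   \<and> (\<forall>(M :: 'b measure) (W :: real \<Rightarrow> 'b \<Rightarrow> real^'d) q0 p0
        (qe :: real \<Rightarrow> real \<Rightarrow> 'b \<Rightarrow> real^'d) pe q p.
        prob_space M \<longrightarrow> std_BM M W \<longrightarrow> q0 \<noteq> 0 \<longrightarrow>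
        (\<forall>\<epsilon>\<in>{0<..<1}. solves M (rel_vel \<epsilon>) (\<lambda>x. gradU x + gradG x) (- {0})
                                W q0 p0 (qe \<epsilon>) (pe \<epsilon>)) \<longrightarrow>
        solves M (\<lambda>P. P) (\<lambda>x. gradU x + gradG x) (- {0}) W q0 p0 q p \<longrightarrow>
        (\<forall>T>0. \<forall>n::nat. n \<ge> 1 \<longrightarrow>
           ((\<lambda>\<epsilon>. \<integral>\<^sup>+ \<omega>. ennreal (SUP t\<in>{0..T}. norm (qe \<epsilon> t \<omega> - q t \<omega>) ^ n
                                          + norm (pe \<epsilon> t \<omega> - p t \<omega>) ^ n) \<partial>M)
             \<longlongrightarrow> 0) (at_right 0)))"
proof -
  interpret singular_potential U gradU G gradG a1 lam \<beta>1 \<beta>2 a4 a5 a6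
  proof
    show "1 / a1 * norm q powr (lam + 1) - a1 \<le> U q" for q
      \<comment> \<open>U \<ge> 1 removes the absolute value from the lower bound.\<close>
      using U_bounds[rule_format, of q] U_ge1[rule_format, of q] by simp
  qed (use assms in blast)+
  have lipU: "loc_lip UNIV gradU"
    by (rule smooth_on_loc_lip_grad[OF U_smooth open_UNIV]) (use U_grad in blast)
  have lipG: "loc_lip (- {0}) gradG"
    by (rule smooth_on_loc_lip_grad[OF G_smooth]) (use G_grad in auto)
  show ?thesis
  proof (intro conjI allI impI)
    fix M :: "'a measure" and W :: "real \<Rightarrow> 'a \<Rightarrow> real^'d^'n" and q0 p0
      and qe pe :: "real \<Rightarrow> real \<Rightarrow> 'a \<Rightarrow> real^'d^'n" and q p and T \<xi> :: real
    assume M: "prob_space M" and bm: "iid_BMs M W"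
      and sole: "\<forall>\<epsilon>\<in>{0<..<1}. solves M (rel_vel_multi \<epsilon>) (force_multi gradU gradG) coll_free
            W q0 p0 (qe \<epsilon>) (pe \<epsilon>)"
      and sol: "solves M (\<lambda>P. P) (force_multi gradU gradG) coll_free W q0 p0 q p"
      and T: "0 < T" and \<xi>: "0 < \<xi>"
    have W0: "W 0 \<omega> = 0" if "\<omega> \<in> space M" for \<omega>
    proof -
      have "W 0 \<omega> $ i = 0" for i
        using bm std_BM_D(3)[of M "\<lambda>t \<omega>. W t \<omega> $ i" \<omega>] that unfolding iid_BMs_def by blast
      then show ?thesis by (simp add: vec_eq_iff)
    qed
    show "((\<lambda>\<epsilon>. prob_space.prob M {\<omega> \<in> space M.
        (SUP t\<in>{0..T}. norm (qe \<epsilon> t \<omega> - q t \<omega>) + norm (pe \<epsilon> t \<omega> - p t \<omega>)) > \<xi>}) \<longlongrightarrow> 0) (at_right 0)"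
      by (rule converge_in_probability[OF M open_coll_free loc_lip_force_multi[OF lipU lipG] W0 T sol
            sole[rule_format] rel_vel_multi_nonexpansive rel_vel_multi_near_id \<xi>]) auto
  next
    fix M :: "'b measure" and W :: "real \<Rightarrow> 'b \<Rightarrow> real^'d" and q0 p0
      and qe pe :: "real \<Rightarrow> real \<Rightarrow> 'b \<Rightarrow> real^'d" and q p and T :: real and n :: nat
    assume bm: "std_BM M W"
      and sole: "\<forall>\<epsilon>\<in>{0<..<1}. solves M (rel_vel \<epsilon>) (\<lambda>x. gradU x + gradG x) (- {0}) W q0 p0 (qe \<epsilon>) (pe \<epsilon>)"
      and sol: "solves M (\<lambda>P. P) (\<lambda>x. gradU x + gradG x) (- {0}) W q0 p0 q p"
      and T: "0 < T" and n: "1 \<le> n"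
    show "((\<lambda>\<epsilon>. \<integral>\<^sup>+ \<omega>. ennreal (SUP t\<in>{0..T}. norm (qe \<epsilon> t \<omega> - q t \<omega>) ^ n
        + norm (pe \<epsilon> t \<omega> - p t \<omega>) ^ n) \<partial>M) \<longlongrightarrow> 0) (at_right 0)"
    proof (rule converge_in_mean[OF lipU lipG bm T n sol sole[rule_format], where C = 1])
      show "kinetic (rel_vel \<epsilon>) (\<lambda>y. (sqrt (1 + \<epsilon> * (norm y)\<^sup>2) - 1) / \<epsilon>)" if "\<epsilon> \<in> {0<..<1}" for \<epsilon>
        using that by (intro kinetic_rel_vel) auto
      show "norm (rel_vel \<epsilon> x - x) \<le> 1 * \<epsilon> * norm x ^ 3" if "\<epsilon> \<in> {0<..<1}" for \<epsilon> and x :: "real^'d"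
        using rel_vel_near_id that by auto
    qed
  qed
qed

end
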